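(* For all integers $r,d,\beta\geq 1$ there exist $c(r,d,\beta)$ and $g(d,\beta)$ such that for every finite set $P$ of moving points in $\mathbb{R}^d$ with description complexity $\beta$ satisfying the general position assumption below, there is a kinetic weak $\frac{1}{r}$-net for $P$ of cardinality at most $c(r,d,\beta)$ and description complexity $g(d,\beta)$. Moreover, for fixed $d$ and $\beta$ and $r\geq 2$, $c(r,d,\beta)=O\!\left(r^{\frac{d(d+1)}{2}}\log^d r\right)$.
   Context: A moving point is a function $p:\mathbb{R}_+\to\mathbb{R}^d\cup\{\emptyset\}$, $p(t)=(p_1(t),\ldots,p_d(t))$; if some coordinate is undefined at $t$, then $p(t)$ is undefined. A set $P$ of moving points has description complexity $\beta$ if every coordinate $p_i$ of every $p\in P$ is a rational function whose numerator and denominator have degree at most $\beta$. For $t\in\mathbb{R}_+$, $P(t)=\{p(t): p\in P\}$. General position assumption on $P$: for every $t\geq 0$, the affine hull of any $d$ points of $P(t)$ is a hyperplane, and no $d+2$ points of $P(t)$ lie in a common hyperplane. With $n=|P|$, a set $N$ of moving points is a kinetic weak $\frac{1}{r}$-net for $P$ if for every $t\in\mathbb{R}_+$ and every convex set $C\subset\mathbb{R}^d$ with $|C\cap P(t)|>n/r$ we have $C\cap N(t)\neq\emptyset$. *)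

theory Defs
  imports "HOL-Analysis.Analysis" "HOL-Computational_Algebra.Polynomial"
begin

text \<open>
  A moving point \<open>\<real>\<^sub>+ \<rightarrow> \<real>\<^sup>d \<union> {\<emptyset>}\<close> is a partial function whose value \<open>None\<close> means
  ``undefined''. Forcing \<open>None\<close> at negative times makes equality of such functions, and hence the
  cardinality of a set of moving points, depend on nonnegative times only.
\<close>

type_synonym 'd moving_point = "real \<rightharpoonup> real ^ 'd"

definition is_moving_point :: "('d::finite) moving_point \<Rightarrow> bool" where
  "is_moving_point p \<longleftrightarrow> dom p \<subseteq> {0..}"

text \<open>
  Numerator and denominator need not be coprime, so a common root may, but need not, leave a hole
  in the domain.
\<close>

definition rational_function :: "nat \<Rightarrow> (real \<rightharpoonup> real) \<Rightarrow> bool" where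
  "rational_function \<beta> f \<longleftrightarrow>
     (\<exists>a b :: real poly. b \<noteq> 0 \<and> degree a \<le> \<beta> \<and> degree b \<le> \<beta> \<and>
        f = (\<lambda>t. if poly b t = 0 then None else Some (poly a t / poly b t)))"

definition has_coordinates ::
    "('d::finite) moving_point \<Rightarrow> ('d \<Rightarrow> (real \<rightharpoonup> real)) \<Rightarrow> bool" where
  "has_coordinates p f \<longleftrightarrow>
     (\<forall>t\<ge>0. p t = (if \<exists>i. f i t = None then None else Some (\<chi> i. the (f i t))))"

definition description_complexity :: "nat \<Rightarrow> ('d::finite) moving_point set \<Rightarrow> bool" where
  "description_complexity \<beta> P \<longleftrightarrow>
     (\<forall>p\<in>P. is_moving_point p \<and>
        (\<exists>f. has_coordinates p f \<and> (\<forall>i. rational_function \<beta> (f i))))"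

definition points_at :: "('d::finite) moving_point set \<Rightarrow> real \<Rightarrow> (real ^ 'd) set" where
  "points_at P t = {x. \<exists>p\<in>P. p t = Some x}"

definition is_hyperplane :: "'a::euclidean_space set \<Rightarrow> bool" where
  "is_hyperplane H \<longleftrightarrow> (\<exists>a b. a \<noteq> 0 \<and> H = {x. a \<bullet> x = b})"

definition general_position :: "('d::finite) moving_point set \<Rightarrow> bool" where
  "general_position P \<longleftrightarrow>
     (\<forall>t\<ge>0.
        (\<forall>S. S \<subseteq> points_at P t \<and> card S = CARD('d) \<longrightarrow> is_hyperplane (affine hull S)) \<and>
        \<not> (\<exists>S H. S \<subseteq> points_at P t \<and> card S = CARD('d) + 2 \<and> is_hyperplane H \<and> S \<subseteq> H))"

definition kinetic_weak_net ::
    "nat \<Rightarrow> ('d::finite) moving_point set \<Rightarrow> 'd moving_point set \<Rightarrow> bool" where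
  "kinetic_weak_net r P N \<longleftrightarrow>
     (\<forall>p\<in>N. is_moving_point p) \<and>
     (\<forall>t\<ge>0. \<forall>C. convex C \<and> real (card (C \<inter> points_at P t)) > real (card P) / real r
        \<longrightarrow> C \<inter> points_at N t \<noteq> {})"

end

theory Submission
  imports Defs "HOL-Real_Asymp.Real_Asymp"
begin

text \<open>
  The net points are chosen coordinate by coordinate. Let \<open>Q\<close> be the points of \<open>P\<close> lying in a heavy
  convex set \<open>C\<close> at time \<open>t\<close>, and suppose that coordinates \<open>1, \<dots>, j\<close> have been fixed to rational
  functions of \<open>t\<close> such that the resulting flat meets the convex hulls of a positive fraction of the
  \<open>(j + 1)\<close>-tuples of \<open>Q\<close>. Each such tuple determines a point of the flat, whose next coordinate is
  obtained by Gaussian elimination and is thus one of boundedly many rational functions of \<open>t\<close>. The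
  middle third of these values spans an interval. Families of rational functions of bounded degree
  have polynomially many traces of (time, interval) pairs, so by the double sampling argument of
  Haussler and Welzl a sample of \<open>O(r\<^sup>j\<^sup>+\<^sup>1 log r)\<close> of them meets every such interval. If the next
  coordinate is fixed to a value in the middle third, a positive fraction of the pairs of tuples lies
  below and above it, and by Caratheodory's theorem every such pair contains a \<open>(j + 2)\<close>-tuple whose
  convex hull meets the new flat. After \<open>d\<close> steps the flat is a point of \<open>C\<close>, and the sample sizes
  multiply to \<open>O(r\<^sup>d\<^sup>(\<^sup>d\<^sup>+\<^sup>1\<^sup>)\<^sup>/\<^sup>2 log\<^sup>d r)\<close>.
\<close>

text \<open>The net is fixed before the time and the convex set, while the position of the points
  relative to each other changes with time. Hence time is made part of the ranges, and every
  candidate is a polynomial expression formed without reference to any time. Elimination threatens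
  this, since the pivots that succeed depend on \<open>t\<close> and tuples may degenerate. The
  remedy is to sample tuples together with pivot sequences: a tuple has at most
  \<open>(j + 2) ^ Suc j\<close> of them, which costs only a constant. A common denominator kept as
  coordinate 0 avoids division and turns convex hulls into cones. The exponent arises because
  \<open>Q\<close> has more than a \<open>1 / r\<close> part of \<open>P\<close>: a fixed fraction
  of its \<open>(j + 1)\<close>-tuples is only a part of order \<open>1 / r ^ Suc j\<close> of all
  those over \<open>P\<close>, and 1 + ... + d is the total. The fraction of hitting tuples drops to
  a constant times its square in each step, and the degree grows by a factor depending on the step.
  Neither involves \<open>r\<close>, so the description complexity of the net does not
  either.\<close>

section \<open>Epsilon-nets\<close>

text \<open>An exponential moment bound. A sample with \<open>h\<close> hits in \<open>R\<close>
  gets the weight \<open>(1/2)^h\<close>; the total weight factorises over the \<open>m\<close>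
  positions, and every sample with fewer than \<open>k\<close> hits weighs at least
  \<open>(1/2)^k\<close>.\<close>

lemma card_few_hits_le:
  fixes X R :: "'a set" and m k :: nat and \<epsilon> :: real
  assumes X: "finite X" and RX: "R \<subseteq> X"
    and heavy: "\<epsilon> * card X \<le> card R"
    and small: "2 ^ k * (1 - \<epsilon> / 2) ^ m \<le> 1 / 2"
  shows "2 * card {y \<in> {..<m} \<rightarrow>\<^sub>E X. card {i. i < m \<and> y i \<in> R} < k} \<le> card X ^ m"
proof -
  let ?Y = "{..<m} \<rightarrow>\<^sub>E X"
  let ?B = "{y \<in> ?Y. card {i. i < m \<and> y i \<in> R} < k}"
  let ?g = "\<lambda>x. if x \<in> R then 1 / 2 else (1::real)"
  have finY: "finite ?Y" using X by (simp add: finite_PiE)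
  have prodg: "(\<Prod>i<m. ?g (y i)) = (1 / 2) ^ card {i. i < m \<and> y i \<in> R}" for y :: "nat \<Rightarrow> 'a"
  proof -
    have "(\<Prod>i<m. ?g (y i)) = (\<Prod>i\<in>{..<m} \<inter> {i. y i \<in> R}. 1 / 2)"
      by (subst prod.inter_restrict) (auto intro!: prod.cong)
    also have "{..<m} \<inter> {i. y i \<in> R} = {i. i < m \<and> y i \<in> R}" by auto
    finally show ?thesis by simp
  qed
  have sumg: "(\<Sum>x\<in>X. ?g x) = card X - card R / 2"
  proof -
    have "(\<Sum>x\<in>X. ?g x) = (\<Sum>x\<in>X. 1 - (if x \<in> R then 1 / 2 else 0))"
      by (intro sum.cong) auto
    also have "\<dots> = card X - (\<Sum>x\<in>X. if x \<in> R then 1 / 2 else 0)"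
      by (simp add: sum_subtractf)
    also have "(\<Sum>x\<in>X. if x \<in> R then 1 / 2 else (0::real)) = (\<Sum>x\<in>X \<inter> R. 1 / 2)"
      using sum.inter_restrict[OF X, of "\<lambda>_. 1 / 2 :: real" R] by simp
    also have "X \<inter> R = R" using RX by auto
    finally show ?thesis by simp
  qed
  have "real (card ?B) * (1 / 2) ^ k = (\<Sum>y\<in>?B. (1 / 2) ^ k)" by simp
  also have "\<dots> \<le> (\<Sum>y\<in>?B. \<Prod>i<m. ?g (y i))"
    unfolding prodg by (intro sum_mono power_decreasing) auto
  also have "\<dots> \<le> (\<Sum>y\<in>?Y. \<Prod>i<m. ?g (y i))"
    unfolding prodg using finY by (intro sum_mono2) auto
  also have "\<dots> = (\<Prod>i<m. \<Sum>x\<in>X. ?g x)"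
    using X by (subst prod_sum_PiE) auto
  also have "\<dots> = (card X - card R / 2) ^ m" by (simp add: sumg)
  also have "\<dots> \<le> ((1 - \<epsilon> / 2) * card X) ^ m"
  proof (intro power_mono)
    have "card R \<le> card X" using X RX by (rule card_mono)
    then show "0 \<le> real (card X) - card R / 2" by simp
    show "real (card X) - card R / 2 \<le> (1 - \<epsilon> / 2) * card X"
      using heavy by (simp add: algebra_simps)
  qed
  finally have "real (card ?B) * (1 / 2) ^ k \<le> (1 - \<epsilon> / 2) ^ m * card X ^ m"
    by (simp add: power_mult_distrib)
  then have "real (card ?B) \<le> (2 ^ k * (1 - \<epsilon> / 2) ^ m) * card X ^ m"
    by (simp add: field_simps power_one_over)
  also have "\<dots> \<le> 1 / 2 * card X ^ m"
    using small by (intro mult_right_mono) auto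
  finally have "real (2 * card ?B) \<le> real (card X ^ m)" by simp
  then show ?thesis by (simp only: of_nat_le_iff)
qed

definition swap_at :: "nat set \<Rightarrow> (nat \<Rightarrow> 'a) \<times> (nat \<Rightarrow> 'a) \<Rightarrow> (nat \<Rightarrow> 'a) \<times> (nat \<Rightarrow> 'a)" where
  "swap_at S z = ((\<lambda>i. if i \<in> S then snd z i else fst z i),
                  (\<lambda>i. if i \<in> S then fst z i else snd z i))"

lemma swap_at_swap_at [simp]: "swap_at S (swap_at S z) = z"
  by (cases z) (auto simp: swap_at_def)

text \<open>At a position of \<open>J\<close> the swap is forced, because an entry in \<tau> has to
  land in the second component. There are at least \<open>k\<close> such positions, and only the
  others are free.\<close>

lemma card_separating_swaps_le:
  fixes z :: "(nat \<Rightarrow> 'a) \<times> (nat \<Rightarrow> 'a)"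
  shows "card {S \<in> Pow {..<m}. (\<forall>i<m. fst (swap_at S z) i \<notin> \<tau>) \<and>
            k \<le> card {i. i < m \<and> snd (swap_at S z) i \<in> \<tau>}} * 2 ^ k \<le> 2 ^ m"
    (is "card ?A * _ \<le> _")
proof (cases "?A = {}")
  case False
  define J where "J = {i. i < m \<and> (fst z i \<in> \<tau> \<or> snd z i \<in> \<tau>)}"
  have forced: "i \<in> S \<longleftrightarrow> fst z i \<in> \<tau>" if "S \<in> ?A" "i \<in> J" for S i
    using that by (auto simp: J_def swap_at_def split: if_splits)
  from False obtain S where S: "S \<in> ?A" by blast
  then have "k \<le> card {i. i < m \<and> snd (swap_at S z) i \<in> \<tau>}" by simp
  also have "\<dots> \<le> card J"
    by (intro card_mono) (auto simp: J_def swap_at_def)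
  finally have kJ: "k \<le> card J" .
  have Jm: "J \<subseteq> {..<m}" by (auto simp: J_def)
  have "inj_on (\<lambda>S. S - J) ?A"
  proof (rule inj_onI)
    fix S S' assume S: "S \<in> ?A" "S' \<in> ?A" "S - J = S' - J"
    show "S = S'" using forced[OF S(1)] forced[OF S(2)] S(3) by blast
  qed
  then have "card ?A = card ((\<lambda>S. S - J) ` ?A)" by (simp add: card_image)
  also have "\<dots> \<le> card (Pow ({..<m} - J))" by (intro card_mono) auto
  also have "\<dots> = 2 ^ (m - card J)"
    using Jm by (simp add: card_Pow card_Diff_subset finite_subset)
  finally have "card ?A \<le> 2 ^ (m - card J)" .
  then have "card ?A * 2 ^ k \<le> 2 ^ (m - card J) * 2 ^ card J"
    using kJ by (intro mult_mono power_increasing) auto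
  also have "\<dots> = 2 ^ m"
    using card_mono[OF _ Jm] by (simp flip: power_add)
  finally show ?thesis .
next
  case True
  show ?thesis unfolding True by simp
qed

text \<open>\<open>B\<close> consists of the pairs of samples such that some range is missed by the
  first and hit at least \<open>k\<close> times by the second. Without a net of size
  \<open>m\<close> it contains at least half of all pairs. Random swaps between the two samples show
  that it contains at most a fraction \<open>\<Phi> / 2 ^ k\<close>, which is less than
  half.\<close>

lemma double_sampling:
  fixes X :: "'a set" and F :: "'a set set" and m k \<Phi> :: nat and \<epsilon> :: real
  assumes X: "finite X" "X \<noteq> {}" and F: "\<And>R. R \<in> F \<Longrightarrow> R \<subseteq> X \<and> \<epsilon> * card X \<le> card R"
    and small: "2 ^ k * (1 - \<epsilon> / 2) ^ m \<le> 1 / 2"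
    and traces: "\<And>V. V \<subseteq> X \<Longrightarrow> card V \<le> 2 * m \<Longrightarrow> card ((\<lambda>R. R \<inter> V) ` F) \<le> \<Phi>"
    and large: "2 * \<Phi> < 2 ^ k"
  shows "\<exists>N\<subseteq>X. card N \<le> m \<and> (\<forall>R\<in>F. R \<inter> N \<noteq> {})"
proof (rule ccontr)
  assume noN: "\<not> ?thesis"
  define Y where "Y = ({..<m} \<rightarrow>\<^sub>E X)"
  have finY: "finite Y" using X by (simp add: finite_PiE Y_def)
  have cardY: "card Y = card X ^ m" using X by (simp add: card_PiE Y_def)
  have finF: "finite F" using F X by (meson PowI finite_Pow_iff finite_subset subsetI)
  define good where "good = (\<lambda>R (z :: (nat \<Rightarrow> 'a) \<times> (nat \<Rightarrow> 'a)). (\<forall>i<m. fst z i \<notin> R) \<and>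
     k \<le> card {i. i < m \<and> snd z i \<in> R})"
  define B where "B = {z \<in> Y \<times> Y. \<exists>R\<in>F. good R z}"
  have finB: "finite B" using finY by (auto simp: B_def)
  have avoid: "\<exists>R\<in>F. \<forall>i<m. x i \<notin> R" if "x \<in> Y" for x
  proof -
    have "x ` {..<m} \<subseteq> X" using that by (auto simp: Y_def)
    moreover have "card (x ` {..<m}) \<le> m" by (metis card_image_le card_lessThan finite_lessThan)
    ultimately obtain R where "R \<in> F" "R \<inter> x ` {..<m} = {}" using noN by blast
    then show ?thesis by (intro bexI[of _ R]) auto
  qed
  have lower: "card X ^ m \<le> 2 * card {y \<in> Y. (x, y) \<in> B}" if x: "x \<in> Y" for x
  proof -
    obtain R where R: "R \<in> F" "\<forall>i<m. x i \<notin> R" using avoid[OF x] by blast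
    have "2 * card {y \<in> Y. card {i. i < m \<and> y i \<in> R} < k} \<le> card X ^ m"
      unfolding Y_def using F[OF R(1)] X small by (intro card_few_hits_le) auto
    moreover have "card Y \<le> card {y \<in> Y. card {i. i < m \<and> y i \<in> R} < k} + card {y \<in> Y. (x, y) \<in> B}"
    proof -
      have "Y \<subseteq> {y \<in> Y. card {i. i < m \<and> y i \<in> R} < k} \<union> {y \<in> Y. (x, y) \<in> B}"
        using R x by (force simp: B_def good_def)
      then have "card Y \<le> card ({y \<in> Y. card {i. i < m \<and> y i \<in> R} < k} \<union> {y \<in> Y. (x, y) \<in> B})"
        using finY by (intro card_mono) auto
      also have "\<dots> \<le> card {y \<in> Y. card {i. i < m \<and> y i \<in> R} < k} + card {y \<in> Y. (x, y) \<in> B}"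
        by (rule card_Un_le)
      finally show ?thesis .
    qed
    ultimately show ?thesis using cardY by linarith
  qed
  have "card X ^ m * card X ^ m = (\<Sum>x\<in>Y. card X ^ m)" by (simp add: cardY)
  also have "\<dots> \<le> (\<Sum>x\<in>Y. 2 * card {y \<in> Y. (x, y) \<in> B})" by (intro sum_mono lower)
  also have "\<dots> = 2 * card (SIGMA x:Y. {y \<in> Y. (x, y) \<in> B})"
    using finY by (simp add: sum_distrib_left card_SigmaI)
  also have "(SIGMA x:Y. {y \<in> Y. (x, y) \<in> B}) = B" by (auto simp: B_def)
  finally have lowB: "card Y * card Y \<le> 2 * card B" by (simp add: cardY)

  have swapY: "swap_at S z \<in> Y \<times> Y" if "z \<in> Y \<times> Y" "S \<subseteq> {..<m}" for S z
    using that by (auto simp: Y_def swap_at_def PiE_iff extensional_def mem_Times_iff split: if_splits)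
  \<comment> \<open>Each swap is an involution of \<open>Y \<times> Y\<close>, so averaging over all
    \<open>S\<close> leaves the size of \<open>B\<close> unchanged.\<close>
  have inv: "card {z \<in> Y \<times> Y. swap_at S z \<in> B} = card B" if "S \<subseteq> {..<m}" for S
  proof (rule bij_betw_same_card[of "swap_at S"], rule bij_betw_byWitness[of _ "swap_at S"])
    have "B \<subseteq> Y \<times> Y" by (auto simp: B_def)
    then show "swap_at S ` B \<subseteq> {z \<in> Y \<times> Y. swap_at S z \<in> B}"
    proof (intro image_subsetI)
      fix z assume "z \<in> B"
      then show "swap_at S z \<in> {z \<in> Y \<times> Y. swap_at S z \<in> B}"
        using swapY[of z S] that \<open>B \<subseteq> Y \<times> Y\<close> unfolding mem_Collect_eq swap_at_swap_at by blast
    qed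
  qed auto
  have upper: "card {S \<in> Pow {..<m}. swap_at S z \<in> B} * 2 ^ k \<le> \<Phi> * 2 ^ m" if z: "z \<in> Y \<times> Y" for z
  proof -
    define V where "V = fst z ` {..<m} \<union> snd z ` {..<m}"
    have "fst z \<in> {..<m} \<rightarrow> X" "snd z \<in> {..<m} \<rightarrow> X"
      using z by (auto simp: Y_def mem_Times_iff PiE_iff)
    then have V: "V \<subseteq> X" unfolding V_def by blast
    have "card V \<le> card (fst z ` {..<m}) + card (snd z ` {..<m})" unfolding V_def by (rule card_Un_le)
    also have "\<dots> \<le> m + m" by (intro add_mono order_trans[OF card_image_le]) auto
    finally have "card V \<le> 2 * m" by simp
    with V have tr: "card ((\<lambda>R. R \<inter> V) ` F) \<le> \<Phi>" by (rule traces)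
    define A where "A = (\<lambda>\<tau>. {S \<in> Pow {..<m}. good \<tau> (swap_at S z)})"
    have mem: "fst (swap_at S z) i \<in> V" "snd (swap_at S z) i \<in> V" if "i < m" for S i
      using that by (auto simp: swap_at_def V_def)
    \<comment> \<open>\<open>V\<close> contains all entries of both samples, before and after the
      swap. So the union bound runs over at most \<Phi> traces instead of all of
      \<open>F\<close>.\<close>
    have "good R (swap_at S z) = good (R \<inter> V) (swap_at S z)" for R S
    proof -
      have "{i. i < m \<and> snd (swap_at S z) i \<in> R \<inter> V} = {i. i < m \<and> snd (swap_at S z) i \<in> R}"
        using mem by auto
      then show ?thesis using mem by (auto simp: good_def)
    qed
    then have "{S \<in> Pow {..<m}. swap_at S z \<in> B} \<subseteq> (\<Union>\<tau>\<in>(\<lambda>R. R \<inter> V) ` F. A \<tau>)"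
      by (auto simp: B_def A_def)
    then have "card {S \<in> Pow {..<m}. swap_at S z \<in> B} \<le> card (\<Union>\<tau>\<in>(\<lambda>R. R \<inter> V) ` F. A \<tau>)"
      using finF by (intro card_mono) (auto simp: A_def)
    also have "\<dots> \<le> (\<Sum>\<tau>\<in>(\<lambda>R. R \<inter> V) ` F. card (A \<tau>))"
      using finF by (intro card_UN_le) auto
    finally have "card {S \<in> Pow {..<m}. swap_at S z \<in> B} * 2 ^ k
        \<le> (\<Sum>\<tau>\<in>(\<lambda>R. R \<inter> V) ` F. card (A \<tau>) * 2 ^ k)"
      by (simp flip: sum_distrib_right)
    also have "\<dots> \<le> (\<Sum>\<tau>\<in>(\<lambda>R. R \<inter> V) ` F. 2 ^ m)"
      unfolding A_def good_def by (intro sum_mono card_separating_swaps_le)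
    also have "\<dots> \<le> \<Phi> * 2 ^ m" using tr by simp
    finally show ?thesis .
  qed
  have "2 ^ m * card B = (\<Sum>S\<in>Pow {..<m}. card {z \<in> Y \<times> Y. swap_at S z \<in> B})"
    by (simp add: inv card_Pow)
  also have "\<dots> = (\<Sum>S\<in>Pow {..<m}. \<Sum>z\<in>Y \<times> Y. if swap_at S z \<in> B then 1 else 0)"
    using finY by (intro sum.cong refl) (simp add: sum.If_cases Int_def)
  also have "\<dots> = (\<Sum>z\<in>Y \<times> Y. \<Sum>S\<in>Pow {..<m}. if swap_at S z \<in> B then 1 else 0)"
    by (rule sum.swap)
  also have "\<dots> = (\<Sum>z\<in>Y \<times> Y. card {S \<in> Pow {..<m}. swap_at S z \<in> B})"
    by (intro sum.cong refl) (simp add: sum.If_cases Int_def)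
  finally have "2 ^ m * card B * 2 ^ k = (\<Sum>z\<in>Y \<times> Y. card {S \<in> Pow {..<m}. swap_at S z \<in> B} * 2 ^ k)"
    by (simp add: sum_distrib_right)
  also have "\<dots> \<le> (\<Sum>z\<in>Y \<times> Y. \<Phi> * 2 ^ m)" by (intro sum_mono upper)
  also have "\<dots> = 2 ^ m * (card Y * card Y * \<Phi>)" by (simp add: card_cartesian_product)
  finally have "2 ^ m * (card B * 2 ^ k) \<le> 2 ^ m * (card Y * card Y * \<Phi>)" by (simp add: mult.assoc)
  then have upB: "card B * 2 ^ k \<le> card Y * card Y * \<Phi>" by simp
  have Ypos: "card Y * card Y > 0" using X by (simp add: cardY card_gt_0_iff)
  have "card Y * card Y * 2 ^ k \<le> 2 * card B * 2 ^ k" using lowB by simp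
  also have "\<dots> \<le> card Y * card Y * (2 * \<Phi>)" using upB by simp
  also have "\<dots> < card Y * card Y * 2 ^ k" using Ypos large by (intro mult_strict_left_mono) auto
  finally show False by simp
qed

text \<open>The base is \<open>sqrt 2\<close> instead of 2 because the other factor
  \<open>sqrt 2 ^ k\<close> of \<open>2 ^ k\<close> is reserved for a power of
  \<open>1 / \<epsilon>\<close>.\<close>

lemma polynomial_below_exponential:
  fixes a :: real and B :: nat
  shows "\<exists>k0. \<forall>k\<ge>k0. a * real (k + 1) ^ B < sqrt 2 ^ k"
proof -
  have "(\<lambda>k. a * real (k + 1) ^ B / sqrt 2 ^ k) \<longlonglongrightarrow> 0" by real_asymp
  then have "eventually (\<lambda>k. a * real (k + 1) ^ B / sqrt 2 ^ k < 1) sequentially"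
    by (rule order_tendstoD) simp
  then show ?thesis by (simp add: eventually_sequentially field_simps)
qed

text \<open>\<open>2 ^ k\<close> must exceed twice the number of traces on \<open>2 * m\<close>
  points, although \<open>m\<close> itself grows like \<open>k / \<epsilon>\<close>; one factor
  \<open>sqrt 2 ^ k\<close> pays for the powers of \<open>k\<close>, the other for those of
  \<open>1 / \<epsilon>\<close>. The bound \<open>\<epsilon> \<le> 1 / 2\<close> keeps
  \<open>ln (1 / \<epsilon>)\<close> away from 0, so that additive constants can be absorbed into
  \<open>K\<close>.\<close>

lemma epsilon_net:
  fixes A B :: nat
  shows "\<exists>K>0. \<forall>(X :: 'a set) F (\<epsilon> :: real). finite X \<longrightarrow> X \<noteq> {} \<longrightarrow> 0 < \<epsilon> \<longrightarrow> \<epsilon> \<le> 1 / 2 \<longrightarrow>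
     (\<forall>R\<in>F. R \<subseteq> X \<and> \<epsilon> * card X \<le> card R) \<longrightarrow>
     (\<forall>V\<subseteq>X. card ((\<lambda>R. R \<inter> V) ` F) \<le> A * (card V + 1) ^ B) \<longrightarrow>
     (\<exists>N\<subseteq>X. card N \<le> K * (1 / \<epsilon>) * ln (1 / \<epsilon>) \<and> (\<forall>R\<in>F. R \<inter> N \<noteq> {}))"
proof -
  \<comment> \<open>The 9 anticipates the estimate \<open>2 * m + 1 \<le> 9 * q\<close>.\<close>
  obtain k0 where k0: "\<And>k. k \<ge> k0 \<Longrightarrow> 2 * real A * 9 ^ B * real (k + 1) ^ B < sqrt 2 ^ k"
    using polynomial_below_exponential[of "2 * real A * 9 ^ B" B] by blast
  define K :: real where "K = 3 * (2 * k0 + 4 + 4 * B)"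
  show ?thesis
  proof (intro exI[of _ K] conjI allI impI)
    show "0 < K" by (simp add: K_def)
    fix X :: "'a set" and F and \<epsilon> :: real
    assume X: "finite X" "X \<noteq> {}" and \<epsilon>: "0 < \<epsilon>" "\<epsilon> \<le> 1 / 2"
      and F: "\<forall>R\<in>F. R \<subseteq> X \<and> \<epsilon> * card X \<le> card R"
      and tr: "\<forall>V\<subseteq>X. card ((\<lambda>R. R \<inter> V) ` F) \<le> A * (card V + 1) ^ B"
    define l where "l = ln (1 / \<epsilon>)"
    have "ln 2 \<le> l" unfolding l_def using \<epsilon> by (subst ln_le_cancel_iff) (auto simp: field_simps)
    then have l: "1 / 2 \<le> l" using ln_2_less_1 ln2_ge_two_thirds by linarith
    \<comment> \<open>The factor 4 suffices for \<open>(1 / \<epsilon>) ^ B \<le> sqrt 2 ^ k\<close>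
      because \<open>ln (sqrt 2)\<close> is at least 1/4.\<close>
    define k where "k = k0 + nat \<lceil>4 * B * l\<rceil>"
    have kl: "4 * B * l \<le> k" unfolding k_def using l by linarith
    have ku: "real (k + 1) \<le> (2 * k0 + 4 + 4 * B) * l"
    proof -
      have "0 \<le> 4 * B * l" using l by simp
      then have "real (k + 1) \<le> k0 + 4 * B * l + 2" unfolding k_def by linarith
      also have "\<dots> \<le> k0 * (2 * l) + 4 * B * l + 2 * (2 * l)"
        using l mult_left_mono[of 1 "2 * l" "real k0"] by simp
      finally show ?thesis by (simp add: algebra_simps)
    qed
    define q where "q = real (k + 1) / \<epsilon>"
    have q: "1 \<le> q" using \<epsilon> by (simp add: q_def field_simps)
    \<comment> \<open>With \<open>m \<ge> 2 * (k + 1) / \<epsilon>\<close> the power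
      \<open>(1 - \<epsilon> / 2) ^ m\<close> is at most \<open>exp (- (k + 1))\<close>, hence at
      most \<open>(1 / 2) ^ (k + 1)\<close>.\<close>
    define m where "m = nat \<lceil>2 * q\<rceil>"
    have ml: "2 * q \<le> m" unfolding m_def by linarith
    have mu: "real m \<le> 3 * q" using q unfolding m_def by linarith
    have small: "2 ^ k * (1 - \<epsilon> / 2) ^ m \<le> 1 / 2"
    proof -
      have "(1 - \<epsilon> / 2) ^ m \<le> exp (- \<epsilon> / 2) ^ m"
        using \<epsilon> exp_ge_add_one_self[of "- \<epsilon> / 2"] by (intro power_mono) auto
      also have "\<dots> = exp (- (m * \<epsilon> / 2))" by (simp flip: exp_of_nat_mult)
      also have "\<dots> \<le> exp (- real (k + 1))" using ml \<epsilon> by (simp add: q_def field_simps)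
      also have "\<dots> = exp (- 1) ^ (k + 1)" by (subst exp_of_nat_mult[symmetric]) simp
      also have "\<dots> \<le> (1 / 2) ^ (k + 1)"
      proof (intro power_mono)
        show "exp (- 1) \<le> (1 / 2 :: real)"
          using exp_ge_add_one_self[of 1] by (simp add: exp_minus field_simps)
      qed simp
      finally have "2 ^ k * (1 - \<epsilon> / 2) ^ m \<le> 2 ^ k * (1 / 2) ^ (k + 1)" by (rule mult_left_mono) simp
      then show ?thesis by (simp add: power_one_over)
    qed
    have large: "2 * (A * (2 * m + 1) ^ B) < 2 ^ k"
    proof -
      have e: "(1 / \<epsilon>) ^ B \<le> sqrt 2 ^ k"
      proof -
        have "(1 / \<epsilon>) ^ B = exp (B * l)" using \<epsilon> by (simp add: l_def exp_of_nat_mult)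
        also have "\<dots> \<le> exp (k * ln (sqrt 2))"
        proof -
          have "B * l * 4 * (1 / 4) \<le> k * ln (sqrt 2)"
            using kl ln2_ge_two_thirds by (intro mult_mono) (auto simp: ln_sqrt)
          then show ?thesis by simp
        qed
        also have "\<dots> = sqrt 2 ^ k" by (simp add: exp_of_nat_mult)
        finally show ?thesis .
      qed
      have "real (2 * m + 1) \<le> 9 * q" using mu q by simp
      then have "real (2 * m + 1) \<le> 9 * real (k + 1) * (1 / \<epsilon>)" by (simp add: q_def)
      then have "real (2 * m + 1) ^ B \<le> (9 * real (k + 1) * (1 / \<epsilon>)) ^ B" by (intro power_mono) auto
      then have "2 * real A * real (2 * m + 1) ^ B \<le> 2 * real A * (9 * real (k + 1) * (1 / \<epsilon>)) ^ B"
        by (intro mult_left_mono) auto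
      also have "\<dots> = (2 * real A * 9 ^ B * real (k + 1) ^ B) * (1 / \<epsilon>) ^ B"
        by (simp only: power_mult_distrib mult.assoc)
      also have "\<dots> \<le> (2 * real A * 9 ^ B * real (k + 1) ^ B) * sqrt 2 ^ k"
        by (intro mult_left_mono e) auto
      also have "\<dots> < sqrt 2 ^ k * sqrt 2 ^ k"
        by (intro mult_strict_right_mono k0) (auto simp: k_def)
      also have "\<dots> = 2 ^ k" by (simp flip: power_mult_distrib)
      finally have "real (2 * (A * (2 * m + 1) ^ B)) < real (2 ^ k)" by simp
      then show ?thesis by (simp only: of_nat_less_iff)
    qed
    have "\<exists>N\<subseteq>X. card N \<le> m \<and> (\<forall>R\<in>F. R \<inter> N \<noteq> {})"
    proof (rule double_sampling[where \<epsilon> = \<epsilon> and k = k and \<Phi> = "A * (2 * m + 1) ^ B"])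
      fix V assume V: "V \<subseteq> X" "card V \<le> 2 * m"
      have "card ((\<lambda>R. R \<inter> V) ` F) \<le> A * (card V + 1) ^ B" using tr V by blast
      also have "\<dots> \<le> A * (2 * m + 1) ^ B" using V by (intro mult_left_mono power_mono) auto
      finally show "card ((\<lambda>R. R \<inter> V) ` F) \<le> A * (2 * m + 1) ^ B" .
    qed (use X F small large in auto)
    moreover have "real m \<le> K * (1 / \<epsilon>) * l"
    proof -
      have "real m \<le> 3 * real (k + 1) / \<epsilon>" using mu by (simp add: q_def)
      also have "\<dots> \<le> 3 * ((2 * k0 + 4 + 4 * B) * l) / \<epsilon>"
        using ku \<epsilon> by (intro divide_right_mono mult_left_mono) auto
      also have "\<dots> = K * (1 / \<epsilon>) * l" by (simp add: K_def algebra_simps add_divide_distrib)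
      finally show ?thesis .
    qed
    ultimately show "\<exists>N\<subseteq>X. card N \<le> K * (1 / \<epsilon>) * ln (1 / \<epsilon>) \<and> (\<forall>R\<in>F. R \<inter> N \<noteq> {})"
      unfolding l_def by (meson of_nat_le_iff order_trans)
  qed
qed

section \<open>Traces of intervals on moving values\<close>

text \<open>A numbering of the cells into which a finite \<open>Z\<close> cuts the line: the two
  counts agree in the open gaps and differ by one at a point of \<open>Z\<close>.\<close>

definition root_cell :: "real set \<Rightarrow> real \<Rightarrow> nat \<times> nat" where
  "root_cell Z t = (card {z \<in> Z. z < t}, card {z \<in> Z. z \<le> t})"

text \<open>Equal counts leave no point of \<open>Z\<close> in the closed interval between
  \<open>t\<close> and \<open>t'\<close>, so a nonzero \<open>q\<close> has no root there and the
  intermediate value theorem forbids a change of sign.\<close>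

lemma sgn_poly_eq_of_root_cell_eq:
  fixes q :: "real poly"
  assumes Z: "finite Z" and roots: "q \<noteq> 0 \<Longrightarrow> {x. poly q x = 0} \<subseteq> Z"
    and eq: "root_cell Z t = root_cell Z t'"
  shows "sgn (poly q t) = sgn (poly q t')"
proof -
  have *: "sgn (poly q t) = sgn (poly q t')"
    if tt: "t < t'" and eq: "root_cell Z t = root_cell Z t'" for t t'
  proof (cases "q = 0")
    case False
    have "{z \<in> Z. z < t} = {z \<in> Z. z < t'}" "{z \<in> Z. z \<le> t} = {z \<in> Z. z \<le> t'}"
      using Z tt eq by (intro card_subset_eq; force simp: root_cell_def)+
    then have "z \<notin> Z" if "t \<le> z" "z \<le> t'" for z
      using that tt by (smt (verit, ccfv_threshold) mem_Collect_eq)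
    then have nz: "poly q z \<noteq> 0" if "t \<le> z" "z \<le> t'" for z
      using roots[OF False] that by auto
    have "\<not> (poly q t < 0 \<and> 0 < poly q t')" "\<not> (0 < poly q t \<and> poly q t' < 0)"
      using poly_IVT_pos[OF tt] poly_IVT_neg[OF tt] nz by (meson less_imp_le)+
    then show ?thesis using nz[of t] nz[of t'] tt by (auto simp: sgn_if)
  qed simp
  show ?thesis
  proof (cases t t' rule: linorder_cases)
    case less
    then show ?thesis using eq by (rule *)
  next
    case greater
    then show ?thesis using eq[symmetric] by (rule *[symmetric])
  qed simp
qed

text \<open>The square is crude, the number of cells being linear in \<open>card Z\<close>, but only
  polynomial growth matters.\<close>

lemma card_root_cells_le:
  assumes "finite Z"
  shows "card (range (root_cell Z)) \<le> (card Z + 1) ^ 2" and "finite (range (root_cell Z))"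
proof -
  have sub: "range (root_cell Z) \<subseteq> {..card Z} \<times> {..card Z}"
    using assms by (auto simp: root_cell_def intro!: card_mono)
  then show "finite (range (root_cell Z))" by (rule finite_subset) simp
  show "card (range (root_cell Z)) \<le> (card Z + 1) ^ 2"
    using card_mono[OF _ sub] by (simp add: power2_eq_square)
qed

text \<open>Values are quotients of polynomials; the condition on the denominator discards the indices
  whose value is undefined at time \<open>t\<close>.\<close>

definition in_range ::
    "('i \<Rightarrow> real poly) \<Rightarrow> ('i \<Rightarrow> real poly) \<Rightarrow> real \<Rightarrow> real \<Rightarrow> real \<Rightarrow> 'i \<Rightarrow> bool" where
  "in_range a b t u v i \<longleftrightarrow>
     poly (b i) t \<noteq> 0 \<and> u \<le> poly (a i) t / poly (b i) t \<and> poly (a i) t / poly (b i) t \<le> v"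

text \<open>Which values are defined and how they compare is determined by the signs of the
  denominators and of the cross differences \<open>a i * b k - a k * b i\<close>. The roots of these
  polynomials cut time into polynomially many cells. In the exponent 6, a share of 4 comes from the
  cells (a quadratic number of polynomials, squared by \<open>root_cell\<close>) and 2 from the two
  extreme members of a trace.\<close>

lemma card_interval_traces_le:
  fixes a b :: "'i \<Rightarrow> real poly"
  assumes V: "finite V" and deg: "\<And>i. i \<in> V \<Longrightarrow> degree (a i) \<le> D \<and> degree (b i) \<le> D"
  shows "card (range (\<lambda>(t, u, v). {i \<in> V. in_range a b t u v i})) \<le> (1 + (2 * D + 1) ^ 2) * (card V + 1) ^ 6"
proof -
  let ?f = "\<lambda>t i. poly (a i) t / poly (b i) t"
  define cmp where "cmp = (\<lambda>(i, k). a i * b k - a k * b i)"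
  define \<Psi> where "\<Psi> = b ` V \<union> cmp ` (V \<times> V)"
  define Z where "Z = (\<Union>q\<in>\<Psi> - {0}. {x. poly q x = 0})"
  have fin\<Psi>: "finite \<Psi>" using V by (auto simp: \<Psi>_def)
  have finZ: "finite Z" using fin\<Psi> by (auto simp: Z_def poly_roots_finite)
  have deg\<Psi>: "degree q \<le> 2 * D" if "q \<in> \<Psi>" for q
  proof -
    have "degree (a i * b k) \<le> 2 * D" if "i \<in> V" "k \<in> V" for i k
      using degree_mult_le[of "a i" "b k"] deg[OF that(1)] deg[OF that(2)] by linarith
    then show ?thesis using \<open>q \<in> \<Psi>\<close> deg
      by (fastforce simp: \<Psi>_def cmp_def intro!: degree_diff_le)
  qed
  have "card Z \<le> (\<Sum>q\<in>\<Psi> - {0}. card {x. poly q x = 0})"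
    unfolding Z_def using fin\<Psi> by (intro card_UN_le) auto
  also have "\<dots> \<le> (\<Sum>q\<in>\<Psi> - {0}. 2 * D)"
    using deg\<Psi> by (intro sum_mono order_trans[OF card_poly_roots_bound]) auto
  also have "\<dots> \<le> card \<Psi> * (2 * D)" using fin\<Psi> by (simp add: card_Diff1_le)
  also have "card \<Psi> \<le> card V + card V * card V"
    unfolding \<Psi>_def using V
    by (intro order_trans[OF card_Un_le] add_mono order_trans[OF card_image_le]) auto
  finally have "card Z + 1 \<le> (card V + card V * card V) * (2 * D) + 1" by simp
  also have "\<dots> \<le> (2 * D + 1) * (card V + 1) ^ 2" by (simp add: power2_eq_square algebra_simps)
  finally have cZ: "card Z + 1 \<le> (2 * D + 1) * (card V + 1) ^ 2" .

  define tr where "tr = (\<lambda>t i l. {k \<in> V. in_range a b t (?f t i) (?f t l) k})"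
  have sgn_eq: "sgn (poly q t) = sgn (poly q t')" if "q \<in> \<Psi>" "root_cell Z t = root_cell Z t'" for q t t'
    using that finZ by (intro sgn_poly_eq_of_root_cell_eq[of Z]) (auto simp: Z_def)
  \<comment> \<open>A nonzero sign is its own inverse, so the sign of a quotient becomes a product
    of three signs, each of them constant on a root cell.\<close>
  have le_sgn: "?f t i \<le> ?f t k \<longleftrightarrow>
      sgn (poly (cmp (i, k)) t) * sgn (poly (b i) t) * sgn (poly (b k) t) \<le> 0"
    if "poly (b i) t \<noteq> 0" "poly (b k) t \<noteq> 0" for t i k
  proof -
    have "?f t i \<le> ?f t k \<longleftrightarrow> sgn (?f t i - ?f t k) \<le> 0" by (simp add: sgn_if)
    also have "?f t i - ?f t k = poly (cmp (i, k)) t / (poly (b i) t * poly (b k) t)"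
      using that by (simp add: cmp_def field_simps)
    also have "sgn \<dots> = sgn (poly (cmp (i, k)) t) * sgn (poly (b i) t) * sgn (poly (b k) t)"
    proof -
      have "inverse (sgn y) = sgn y" for y :: real by (simp add: sgn_if)
      then show ?thesis by (simp add: divide_inverse sgn_mult)
    qed
    finally show ?thesis .
  qed
  have tr_eq: "tr t i l = tr t' i l"
    if "root_cell Z t = root_cell Z t'" "i \<in> V" "l \<in> V"
      "poly (b i) t \<noteq> 0" "poly (b l) t \<noteq> 0" for t t' i l
  proof -
    have sb: "sgn (poly (b k) t) = sgn (poly (b k) t')" if "k \<in> V" for k
      by (rule sgn_eq) (use that \<open>root_cell Z t = root_cell Z t'\<close> in \<open>auto simp: \<Psi>_def\<close>)
    have sc: "sgn (poly (cmp (k, k')) t) = sgn (poly (cmp (k, k')) t')" if "k \<in> V" "k' \<in> V" for k k'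
      by (rule sgn_eq) (use that \<open>root_cell Z t = root_cell Z t'\<close> in \<open>auto simp: \<Psi>_def\<close>)
    have nz: "poly (b k) t \<noteq> 0 \<longleftrightarrow> poly (b k) t' \<noteq> 0" if "k \<in> V" for k
      using sb[OF that] by (metis sgn_0_0)
    have "in_range a b t (?f t i) (?f t l) k = in_range a b t' (?f t' i) (?f t' l) k" if "k \<in> V" for k
    proof (cases "poly (b k) t = 0")
      case True
      then show ?thesis using nz[OF \<open>k \<in> V\<close>] by (auto simp: in_range_def)
    next
      case False
      then show ?thesis
        using that \<open>i \<in> V\<close> \<open>l \<in> V\<close> \<open>poly (b i) t \<noteq> 0\<close> \<open>poly (b l) t \<noteq> 0\<close> nz sb sc
        unfolding in_range_def by (simp add: le_sgn)
    qed
    then show ?thesis by (auto simp: tr_def)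
  qed
  text \<open>A trace depends only on the root cell of the time and on its smallest and largest member.\<close>
  define rep where "rep = (\<lambda>(c, i, l). SOME t. root_cell Z t = c \<and> poly (b i) t \<noteq> 0 \<and> poly (b l) t \<noteq> 0)"
  have "range (\<lambda>(t, u, v). {i \<in> V. in_range a b t u v i})
      \<subseteq> insert {} ((\<lambda>(c, i, l). tr (rep (c, i, l)) i l) ` (range (root_cell Z) \<times> V \<times> V))"
    (is "_ \<subseteq> insert {} ?I")
  proof (rule image_subsetI)
    fix w :: "real \<times> real \<times> real"
    obtain t u v where w: "w = (t, u, v)" by (cases w)
    define W where "W = {i \<in> V. in_range a b t u v i}"
    have "W \<in> insert {} ?I"
    proof (cases "W = {}")
      case False
      have W: "finite W" "W \<noteq> {}" "W \<subseteq> V" using V False by (auto simp: W_def)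
      obtain i where i: "i \<in> W" "\<And>k. k \<in> W \<Longrightarrow> ?f t i \<le> ?f t k"
        using that[OF arg_min_if_finite(1)[OF W(1,2)] arg_min_least[OF W(1,2)]] .
      obtain l where l: "l \<in> W" "\<And>k. k \<in> W \<Longrightarrow> ?f t k \<le> ?f t l"
        using that[OF arg_min_if_finite(1)[OF W(1,2), of "\<lambda>k. - ?f t k"]]
          arg_min_least[OF W(1,2), of _ "\<lambda>k. - ?f t k"] by simp
      \<comment> \<open>The interval from \<open>u\<close> to \<open>v\<close> can be shrunk to the
        span of the values that it catches.\<close>
      have "W = tr t i l"
        using i l by (force simp: W_def tr_def in_range_def)
      moreover have il: "i \<in> V" "l \<in> V" "poly (b i) t \<noteq> 0" "poly (b l) t \<noteq> 0"
        using i(1) l(1) by (auto simp: W_def in_range_def)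
      moreover have "\<exists>s. root_cell Z s = root_cell Z t \<and> poly (b i) s \<noteq> 0 \<and> poly (b l) s \<noteq> 0"
        using il by blast
      then have "root_cell Z (rep (root_cell Z t, i, l)) = root_cell Z t"
        unfolding rep_def by (metis (mono_tags, lifting) case_prod_conv someI_ex)
      ultimately have "W = tr (rep (root_cell Z t, i, l)) i l" using tr_eq by metis
      then show ?thesis using il by (intro insertI2 image_eqI[of _ _ "(root_cell Z t, i, l)"]) auto
    qed simp
    then show "(case w of (t, u, v) \<Rightarrow> {i \<in> V. in_range a b t u v i}) \<in> insert {} ?I"
      by (simp add: w W_def)
  qed
  then have "card (range (\<lambda>(t, u, v). {i \<in> V. in_range a b t u v i}))
      \<le> card (insert {} ?I)"
    using V card_root_cells_le(2)[OF finZ] by (intro card_mono) auto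
  also have "\<dots> \<le> 1 + card ?I"
    using V card_root_cells_le(2)[OF finZ] by (simp add: card_insert_if)
  also have "\<dots> \<le> 1 + card (range (root_cell Z) \<times> V \<times> V)"
    using V card_root_cells_le(2)[OF finZ] by (intro add_left_mono card_image_le) auto
  also have "\<dots> = 1 + card (range (root_cell Z)) * (card V * card V)" by (simp add: card_cartesian_product)
  also have "\<dots> \<le> 1 + ((2 * D + 1) * (card V + 1) ^ 2) ^ 2 * ((card V + 1) * (card V + 1))"
    using card_root_cells_le(1)[OF finZ] cZ
    by (intro add_mono mult_mono order_refl order_trans[OF card_root_cells_le(1)[OF finZ]] power_mono) auto
  also have "\<dots> = 1 + (2 * D + 1) ^ 2 * (card V + 1) ^ 6"
  proof -
    have "(p * x ^ 2) ^ 2 * (x * x) = p ^ 2 * x ^ 6" for p x :: nat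
      by (simp add: eval_nat_numeral)
    then show ?thesis by (simp only:)
  qed
  also have "\<dots> \<le> (1 + (2 * D + 1) ^ 2) * (card V + 1) ^ 6"
  proof -
    have *: "1 + c * x \<le> (1 + c) * x" if "1 \<le> x" for c x :: nat using that by simp
    show ?thesis by (rule *) (rule one_le_power, simp)
  qed
  finally show ?thesis .
qed

text \<open>The ranges are indexed by \<open>t\<close> together with \<open>u\<close> and
  \<open>v\<close>, so one sample, chosen in advance, works at all times.\<close>

lemma kinetic_interval_net:
  fixes D :: nat
  shows "\<exists>K>0. \<forall>(X :: 'i set) a b (\<epsilon> :: real). finite X \<longrightarrow> X \<noteq> {} \<longrightarrow> 0 < \<epsilon> \<longrightarrow> \<epsilon> \<le> 1 / 2 \<longrightarrow>
     (\<forall>i\<in>X. degree (a i) \<le> D \<and> degree (b i) \<le> D) \<longrightarrow>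
     (\<exists>N\<subseteq>X. card N \<le> K * (1 / \<epsilon>) * ln (1 / \<epsilon>) \<and>
       (\<forall>t u v. \<epsilon> * card X \<le> card {i \<in> X. in_range a b t u v i} \<longrightarrow>
          (\<exists>i\<in>N. in_range a b t u v i)))"
proof -
  obtain K :: real where K: "K > 0" and net: "\<And>(X :: 'i set) F (\<epsilon> :: real). \<lbrakk>finite X; X \<noteq> {}; 0 < \<epsilon>; \<epsilon> \<le> 1 / 2;
     \<forall>R\<in>F. R \<subseteq> X \<and> \<epsilon> * card X \<le> card R;
     \<forall>V\<subseteq>X. card ((\<lambda>R. R \<inter> V) ` F) \<le> (1 + (2 * D + 1) ^ 2) * (card V + 1) ^ 6\<rbrakk> \<Longrightarrow>
     \<exists>N\<subseteq>X. card N \<le> K * (1 / \<epsilon>) * ln (1 / \<epsilon>) \<and> (\<forall>R\<in>F. R \<inter> N \<noteq> {})"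
    using epsilon_net[of "1 + (2 * D + 1) ^ 2" 6] by blast
  show ?thesis
  proof (intro exI[of _ K] conjI allI impI K)
    fix X :: "'i set" and a b :: "'i \<Rightarrow> real poly" and \<epsilon> :: real
    assume X: "finite X" "X \<noteq> {}" and \<epsilon>: "0 < \<epsilon>" "\<epsilon> \<le> 1 / 2"
      and deg: "\<forall>i\<in>X. degree (a i) \<le> D \<and> degree (b i) \<le> D"
    define F where "F = {R. \<exists>t u v. R = {i \<in> X. in_range a b t u v i} \<and> \<epsilon> * card X \<le> card R}"
    have "\<exists>N\<subseteq>X. card N \<le> K * (1 / \<epsilon>) * ln (1 / \<epsilon>) \<and> (\<forall>R\<in>F. R \<inter> N \<noteq> {})"
    proof (rule net[OF X \<epsilon>])
      show "\<forall>R\<in>F. R \<subseteq> X \<and> \<epsilon> * card X \<le> card R" by (auto simp: F_def)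
      show "\<forall>V\<subseteq>X. card ((\<lambda>R. R \<inter> V) ` F) \<le> (1 + (2 * D + 1) ^ 2) * (card V + 1) ^ 6"
      proof (intro allI impI)
        fix V assume V: "V \<subseteq> X"
        then have finV: "finite V" using X by (rule_tac finite_subset)
        have "(\<lambda>R. R \<inter> V) ` F \<subseteq> range (\<lambda>(t, u, v). {i \<in> V. in_range a b t u v i})"
        proof clarify
          fix R assume "R \<in> F"
          then obtain t u v where "R = {i \<in> X. in_range a b t u v i}" by (auto simp: F_def)
          then have "R \<inter> V = {i \<in> V. in_range a b t u v i}" using V by auto
          then show "R \<inter> V \<in> range (\<lambda>(t, u, v). {i \<in> V. in_range a b t u v i})"
            by (intro image_eqI[of _ _ "(t, u, v)"]) auto
        qed
        moreover have "finite (range (\<lambda>(t, u, v). {i \<in> V. in_range a b t u v i}))"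
          by (rule finite_subset[of _ "Pow V"]) (use finV in auto)
        ultimately have "card ((\<lambda>R. R \<inter> V) ` F) \<le> card (range (\<lambda>(t, u, v). {i \<in> V. in_range a b t u v i}))"
          by (intro card_mono)
        also have "\<dots> \<le> (1 + (2 * D + 1) ^ 2) * (card V + 1) ^ 6"
          by (rule card_interval_traces_le) (use finV V deg in auto)
        finally show "card ((\<lambda>R. R \<inter> V) ` F) \<le> (1 + (2 * D + 1) ^ 2) * (card V + 1) ^ 6" .
      qed
    qed
    then obtain N where N: "N \<subseteq> X" "card N \<le> K * (1 / \<epsilon>) * ln (1 / \<epsilon>)" "\<forall>R\<in>F. R \<inter> N \<noteq> {}" by blast
    have "\<exists>i\<in>N. in_range a b t u v i" if "\<epsilon> * card X \<le> card {i \<in> X. in_range a b t u v i}" for t u v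
    proof -
      have "{i \<in> X. in_range a b t u v i} \<in> F" using that by (auto simp: F_def)
      then have "{i \<in> X. in_range a b t u v i} \<inter> N \<noteq> {}" using N(3) by simp
      then show ?thesis by auto
    qed
    then show "\<exists>N\<subseteq>X. card N \<le> K * (1 / \<epsilon>) * ln (1 / \<epsilon>) \<and>
       (\<forall>t u v. \<epsilon> * card X \<le> card {i \<in> X. in_range a b t u v i} \<longrightarrow> (\<exists>i\<in>N. in_range a b t u v i))"
      using N(1,2) by (intro exI[of _ N]) simp
  qed
qed

section \<open>Cones and elimination\<close>

text \<open>If coordinate 0 of \<open>a\<close> and of all \<open>v i\<close> is 1, the equation for
  \<open>k = 0\<close> says that the weights sum to 1, and this is membership in the convex hull,
  projected to coordinates 1 to \<open>j\<close>.\<close>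

definition in_cone :: "('i \<Rightarrow> nat \<Rightarrow> real) \<Rightarrow> 'i set \<Rightarrow> nat \<Rightarrow> (nat \<Rightarrow> real) \<Rightarrow> bool" where
  "in_cone v S j a \<longleftrightarrow> (\<exists>\<mu>. (\<forall>i\<in>S. 0 \<le> \<mu> i) \<and> (\<forall>k\<le>j. (\<Sum>i\<in>S. \<mu> i * v i k) = a k))"

definition indep_upto :: "('i \<Rightarrow> nat \<Rightarrow> real) \<Rightarrow> 'i set \<Rightarrow> nat \<Rightarrow> bool" where
  "indep_upto v S j \<longleftrightarrow> (\<forall>\<nu>. (\<forall>k\<le>j. (\<Sum>i\<in>S. \<nu> i * v i k) = 0) \<longrightarrow> (\<forall>i\<in>S. \<nu> i = 0))"

text \<open>Gaussian elimination by induction on the number of equations: a vector \<open>q\<close>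
  that is nonzero in coordinate \<open>n\<close> clears this coordinate in all the others, and its
  own coefficient is chosen afterwards.\<close>

lemma exists_linear_dependence:
  fixes v :: "'i \<Rightarrow> nat \<Rightarrow> real"
  assumes "finite S" "n < card S"
  shows "\<exists>\<nu>. (\<forall>k<n. (\<Sum>i\<in>S. \<nu> i * v i k) = 0) \<and> (\<exists>i\<in>S. \<nu> i \<noteq> 0)"
  using assms
proof (induction n arbitrary: S v)
  case 0
  then obtain i where "i \<in> S" by (metis card.empty ex_in_conv less_numeral_extra(3))
  then show ?case by (intro exI[of _ "\<lambda>_. 1"]) auto
next
  case (Suc n)
  show ?case
  proof (cases "\<exists>q\<in>S. v q n \<noteq> 0")
    case False
    obtain \<nu> where \<nu>: "\<forall>k<n. (\<Sum>i\<in>S. \<nu> i * v i k) = 0" "\<exists>i\<in>S. \<nu> i \<noteq> 0"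
      using Suc.IH[of S v] Suc.prems by auto
    then have "\<forall>k<Suc n. (\<Sum>i\<in>S. \<nu> i * v i k) = 0" using False by (auto simp: less_Suc_eq)
    then show ?thesis using \<nu>(2) by blast
  next
    case True
    then obtain q where q: "q \<in> S" "v q n \<noteq> 0" by blast
    define v' where "v' = (\<lambda>i k. v i k - v i n / v q n * v q k)"
    obtain \<nu> where \<nu>: "\<forall>k<n. (\<Sum>i\<in>S - {q}. \<nu> i * v' i k) = 0" "\<exists>i\<in>S - {q}. \<nu> i \<noteq> 0"
      using Suc.IH[of "S - {q}" v'] Suc.prems q(1) by (auto simp: less_diff_conv)
    define c where "c = (\<Sum>i\<in>S - {q}. \<nu> i * (v i n / v q n))"
    have sum_eq: "(\<Sum>i\<in>S. (\<nu>(q := - c)) i * v i k) = (\<Sum>i\<in>S - {q}. \<nu> i * v' i k)" for k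
    proof -
      have "(\<Sum>i\<in>S. (\<nu>(q := - c)) i * v i k) = - c * v q k + (\<Sum>i\<in>S - {q}. (\<nu>(q := - c)) i * v i k)"
        using Suc.prems(1) q(1) by (simp add: sum.remove)
      also have "(\<Sum>i\<in>S - {q}. (\<nu>(q := - c)) i * v i k) = (\<Sum>i\<in>S - {q}. \<nu> i * v i k)"
        by (intro sum.cong) auto
      also have "- c * v q k + \<dots> = (\<Sum>i\<in>S - {q}. \<nu> i * v' i k)"
        by (simp add: c_def v'_def sum_distrib_right right_diff_distrib sum_subtractf mult.assoc)
      finally show ?thesis .
    qed
    have "(\<Sum>i\<in>S - {q}. \<nu> i * v' i n) = 0" using q(2) by (simp add: v'_def)
    then have "\<forall>k<Suc n. (\<Sum>i\<in>S. (\<nu>(q := - c)) i * v i k) = 0"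
      using \<nu>(1) unfolding sum_eq by (auto simp: less_Suc_eq)
    moreover have "\<exists>i\<in>S. (\<nu>(q := - c)) i \<noteq> 0" using \<nu>(2) by auto
    ultimately show ?thesis by blast
  qed
qed

lemma card_indep_upto_le:
  assumes "finite S" "indep_upto v S j"
  shows "card S \<le> Suc j"
proof (rule ccontr)
  assume "\<not> card S \<le> Suc j"
  then obtain \<nu> where "\<forall>k<Suc j. (\<Sum>i\<in>S. \<nu> i * v i k) = 0" "\<exists>i\<in>S. \<nu> i \<noteq> 0"
    using exists_linear_dependence[of S "Suc j" v] assms(1) by auto
  then show False using assms(2) by (auto simp: indep_upto_def less_Suc_eq_le)
qed

lemma in_cone_mono:
  assumes "in_cone v S j a" "S \<subseteq> S'" "finite S'"
  shows "in_cone v S' j a"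
proof -
  obtain \<mu> where \<mu>: "\<forall>i\<in>S. 0 \<le> \<mu> i" "\<forall>k\<le>j. (\<Sum>i\<in>S. \<mu> i * v i k) = a k"
    using assms(1) by (auto simp: in_cone_def)
  have "(\<Sum>i\<in>S'. (if i \<in> S then \<mu> i else 0) * v i k) = (\<Sum>i\<in>S. \<mu> i * v i k)" for k
    by (rule sum.mono_neutral_cong_right) (use assms in auto)
  then show ?thesis unfolding in_cone_def
    using \<mu> by (intro exI[of _ "\<lambda>i. if i \<in> S then \<mu> i else 0"]) auto
qed

text \<open>A dependence is subtracted from the weights until the first weight vanishes, and that
  index is dropped. Coordinate 0 counts as an equation, so an independent set has at most
  \<open>j + 1\<close> elements, the usual Caratheodory number in dimension
  \<open>j\<close>.\<close>

lemma conic_caratheodory: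
  assumes "finite S" "in_cone v S j a"
  shows "\<exists>I\<subseteq>S. in_cone v I j a \<and> indep_upto v I j"
  using assms
proof (induction "card S" arbitrary: S rule: less_induct)
  case less
  show ?case
  proof (cases "indep_upto v S j")
    case True
    then show ?thesis using less.prems by blast
  next
    case False
    then obtain \<nu>0 i0 where \<nu>0: "\<forall>k\<le>j. (\<Sum>i\<in>S. \<nu>0 i * v i k) = 0" "i0 \<in> S" "\<nu>0 i0 \<noteq> 0"
      by (auto simp: indep_upto_def)
    \<comment> \<open>The sign makes the coefficient at \<open>i0\<close> positive, so that some
      weight decreases and a minimal ratio exists.\<close>
    define \<nu> where "\<nu> = (\<lambda>i. sgn (\<nu>0 i0) * \<nu>0 i)"
    have \<nu>: "(\<Sum>i\<in>S. \<nu> i * v i k) = 0" if "k \<le> j" for k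
      using \<nu>0(1) that by (simp add: \<nu>_def mult.assoc flip: sum_distrib_left)
    have pos: "\<nu> i0 > 0" using \<nu>0(3) by (simp add: \<nu>_def sgn_if)
    obtain \<mu> where \<mu>: "\<forall>i\<in>S. 0 \<le> \<mu> i" "\<forall>k\<le>j. (\<Sum>i\<in>S. \<mu> i * v i k) = a k"
      using less.prems(2) by (auto simp: in_cone_def)
    define W where "W = {i \<in> S. 0 < \<nu> i}"
    have W: "finite W" "W \<noteq> {}" using less.prems(1) pos \<nu>0(2) by (auto simp: W_def)
    obtain q where q: "q \<in> W" "\<And>i. i \<in> W \<Longrightarrow> \<mu> q / \<nu> q \<le> \<mu> i / \<nu> i"
      using that[OF arg_min_if_finite(1)[OF W] arg_min_least[OF W]] .
    define \<tau> where "\<tau> = \<mu> q / \<nu> q"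
    have qS: "q \<in> S" "\<nu> q > 0" using q(1) by (auto simp: W_def)
    have \<tau>0: "\<tau> \<ge> 0" using qS \<mu>(1) by (simp add: \<tau>_def)
    define \<mu>' where "\<mu>' = (\<lambda>i. \<mu> i - \<tau> * \<nu> i)"
    have q0: "\<mu>' q = 0" using qS by (simp add: \<mu>'_def \<tau>_def)
    have nonneg: "0 \<le> \<mu>' i" if "i \<in> S" for i
    proof (cases "0 < \<nu> i")
      case True
      then have "\<tau> \<le> \<mu> i / \<nu> i" using q(2)[of i] that by (auto simp: W_def \<tau>_def)
      then show ?thesis using True by (simp add: \<mu>'_def pos_le_divide_eq)
    next
      case False
      then have "\<tau> * \<nu> i \<le> 0" using \<tau>0 by (simp add: mult_nonneg_nonpos)
      then show ?thesis using \<mu>(1) that by (auto simp: \<mu>'_def intro: order_trans)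
    qed
    have "(\<Sum>i\<in>S - {q}. \<mu>' i * v i k) = a k" if "k \<le> j" for k
    proof -
      have "(\<Sum>i\<in>S. \<mu>' i * v i k) = (\<Sum>i\<in>S. \<mu> i * v i k) - \<tau> * (\<Sum>i\<in>S. \<nu> i * v i k)"
        by (simp add: \<mu>'_def algebra_simps sum_subtractf sum_distrib_left)
      also have "\<dots> = a k" using \<mu>(2) \<nu>[OF that] that by simp
      finally show ?thesis using less.prems(1) qS q0 by (simp add: sum.remove)
    qed
    then have "in_cone v (S - {q}) j a" unfolding in_cone_def using nonneg by (intro exI[of _ \<mu>']) auto
    moreover have "card (S - {q}) < card S" using less.prems(1) qS(1) by (rule card_Diff1_less)
    ultimately obtain I where "I \<subseteq> S - {q}" "in_cone v I j a" "indep_upto v I j"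
      using less.hyps[of "S - {q}"] less.prems(1) by auto
    then show ?thesis by blast
  qed
qed

text \<open>The two cones contain points that agree with \<open>a\<close> up to coordinate
  \<open>j\<close> and lie on opposite sides of it in the last one; \<open>a\<close> is on the
  segment between them.\<close>

lemma in_cone_extend:
  assumes "finite S" "finite S'" "S \<inter> S' = {}"
    and "in_cone v S (Suc j) (a(Suc j := y))" "in_cone v S' (Suc j) (a(Suc j := y'))"
    and "y \<le> a (Suc j)" "a (Suc j) \<le> y'"
  shows "in_cone v (S \<union> S') (Suc j) a"
proof -
  obtain \<theta> where \<theta>: "0 \<le> \<theta>" "\<theta> \<le> 1" "a (Suc j) = (1 - \<theta>) * y + \<theta> * y'"
  proof (cases "y = y'")
    case True
    then show ?thesis using that[of 0] assms by simp
  next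
    case False
    then have "y < y'" using assms by simp
    define \<theta> where "\<theta> = (a (Suc j) - y) / (y' - y)"
    have "\<theta> * (y' - y) = a (Suc j) - y" using \<open>y < y'\<close> by (simp add: \<theta>_def)
    moreover have "0 \<le> \<theta>" "\<theta> \<le> 1" using \<open>y < y'\<close> assms(6,7) by (simp_all add: \<theta>_def)
    ultimately show ?thesis using that[of \<theta>] by (simp add: algebra_simps)
  qed
  obtain \<mu> where \<mu>: "\<forall>i\<in>S. 0 \<le> \<mu> i" "\<forall>k\<le>Suc j. (\<Sum>i\<in>S. \<mu> i * v i k) = (a(Suc j := y)) k"
    using assms(4) by (auto simp: in_cone_def)
  obtain \<mu>' where \<mu>': "\<forall>i\<in>S'. 0 \<le> \<mu>' i" "\<forall>k\<le>Suc j. (\<Sum>i\<in>S'. \<mu>' i * v i k) = (a(Suc j := y')) k"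
    using assms(5) by (auto simp: in_cone_def)
  define \<kappa> where "\<kappa> = (\<lambda>i. if i \<in> S then (1 - \<theta>) * \<mu> i else \<theta> * \<mu>' i)"
  have "(\<Sum>i\<in>S \<union> S'. \<kappa> i * v i k) = a k" if "k \<le> Suc j" for k
  proof -
    have "(\<Sum>i\<in>S \<union> S'. \<kappa> i * v i k) = (\<Sum>i\<in>S. \<kappa> i * v i k) + (\<Sum>i\<in>S'. \<kappa> i * v i k)"
      using assms by (intro sum.union_disjoint) auto
    also have "(\<Sum>i\<in>S. \<kappa> i * v i k) = (1 - \<theta>) * (\<Sum>i\<in>S. \<mu> i * v i k)"
      by (simp add: \<kappa>_def sum_distrib_left mult.assoc)
    also have "(\<Sum>i\<in>S'. \<kappa> i * v i k) = \<theta> * (\<Sum>i\<in>S'. \<mu>' i * v i k)"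
      unfolding sum_distrib_left using assms(3) by (intro sum.cong) (auto simp: \<kappa>_def)
    also have "(1 - \<theta>) * (\<Sum>i\<in>S. \<mu> i * v i k) + \<theta> * (\<Sum>i\<in>S'. \<mu>' i * v i k)
        = (1 - \<theta>) * (a(Suc j := y)) k + \<theta> * (a(Suc j := y')) k"
      using \<mu>(2) \<mu>'(2) that by (simp del: fun_upd_apply)
    also have "\<dots> = a k" using \<theta> by (simp add: algebra_simps)
    finally show ?thesis .
  qed
  then show ?thesis unfolding in_cone_def
    using \<mu>(1) \<mu>'(1) \<theta> by (intro exI[of _ \<kappa>]) (auto simp: \<kappa>_def)
qed

text \<open>Division-free elimination, so that it applies to vectors of polynomials. A pivot index
  beyond \<open>j\<close> means that the vector is skipped.\<close>

definition elim_coord :: "nat \<Rightarrow> (nat \<Rightarrow> 'a::comm_ring_1) \<Rightarrow> (nat \<Rightarrow> 'a) \<Rightarrow> (nat \<Rightarrow> 'a)" where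
  "elim_coord c v u = (\<lambda>k. v c * u k - u c * v k)"

function reduce :: "nat \<Rightarrow> ((nat \<Rightarrow> 'a::comm_ring_1) \<times> nat) list \<Rightarrow> (nat \<Rightarrow> 'a) \<Rightarrow> (nat \<Rightarrow> 'a)" where
  "reduce j [] u = u"
| "reduce j ((v, c) # L) u =
     (if j < c then reduce j L u
      else reduce j (map (map_prod (elim_coord c v) id) L) (elim_coord c v u))"
  by pat_completeness auto
termination by (relation "Wellfounded.measure (\<lambda>(j, L, u). length L)") auto

text \<open>Without division, elimination commutes with evaluation: it is carried out once on
  polynomials, while its correctness is argued with real numbers at a single time.\<close>

lemma poly_reduce:
  fixes L :: "((nat \<Rightarrow> real poly) \<times> nat) list"
  shows "poly (reduce j L u k) t = reduce j (map (map_prod (\<lambda>v k. poly (v k) t) id) L) (\<lambda>k. poly (u k) t) k"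
proof (induction j L u rule: reduce.induct)
  case (2 j v c L u)
  have elim: "(\<lambda>k. poly (elim_coord c v w k) t) = elim_coord c (\<lambda>k. poly (v k) t) (\<lambda>k. poly (w k) t)" for w
    by (simp add: elim_coord_def)
  show ?case using 2 by (simp add: elim o_def map_prod_def case_prod_beta)
qed simp

text \<open>Each pivot step forms products of two entries and so at most doubles the degree
  bound.\<close>

lemma degree_reduce_le:
  fixes L :: "((nat \<Rightarrow> real poly) \<times> nat) list"
  assumes "\<And>k. k \<le> Suc j \<Longrightarrow> degree (u k) \<le> D" "\<And>v c k. (v, c) \<in> set L \<Longrightarrow> k \<le> Suc j \<Longrightarrow> degree (v k) \<le> D"
    and "k \<le> Suc j"
  shows "degree (reduce j L u k) \<le> 2 ^ length L * D"
  using assms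
proof (induction j L u arbitrary: D rule: reduce.induct)
  case (2 j v c L u)
  show ?case
  proof (cases "j < c")
    case True
    then have "degree (reduce j ((v, c) # L) u k) \<le> 2 ^ length L * D"
      using 2(1)[OF True, of D] 2(3-5) by force
    also have "\<dots> \<le> 2 ^ length ((v, c) # L) * D" by simp
    finally show ?thesis .
  next
    case False
    have elim: "degree (elim_coord c v w i) \<le> 2 * D"
      if "\<And>k. k \<le> Suc j \<Longrightarrow> degree (w k) \<le> D" "i \<le> Suc j" for w i
    proof -
      have v: "degree (v k) \<le> D" if "k \<le> Suc j" for k using 2(4)[of v c k] that by simp
      have "degree (v c * w i) \<le> 2 * D" "degree (w c * v i) \<le> 2 * D"
        using v[of c] v[of i] that(1)[of c] that(1)[of i] that(2) False
          degree_mult_le[of "v c" "w i"] degree_mult_le[of "w c" "v i"] by linarith+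
      then show ?thesis unfolding elim_coord_def by (rule degree_diff_le)
    qed
    have "degree (reduce j (map (map_prod (elim_coord c v) id) L) (elim_coord c v u) k)
        \<le> 2 ^ length (map (map_prod (elim_coord c v) id) L) * (2 * D)"
    proof (rule 2(2)[OF False])
      show "degree (elim_coord c v u k) \<le> 2 * D" if "k \<le> Suc j" for k
        by (rule elim) (use 2(3) that in auto)
      fix w c' k assume "(w, c') \<in> set (map (map_prod (elim_coord c v) id) L)" "k \<le> Suc j"
      then obtain w0 where "w = elim_coord c v w0" "(w0, c') \<in> set L" by auto
      then show "degree (w k) \<le> 2 * D" using elim[of w0 k] 2(4)[of w0 c'] \<open>k \<le> Suc j\<close> by auto
    qed (rule 2(5))
    then show ?thesis using False by (simp add: mult_ac)
  qed
qed simp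

text \<open>Eliminating an independent subfamily (the indices in \<open>I\<close>) with suitable pivots recovers, up to
  the nonzero factor \<open>s\<close>, the last coordinate of a linear combination from its other coordinates.\<close>

lemma exists_pivots:
  fixes vs :: "(nat \<Rightarrow> real) list"
  assumes "\<And>\<nu>. (\<forall>i. i \<notin> I \<longrightarrow> \<nu> i = 0) \<Longrightarrow> (\<forall>k\<le>j. (\<Sum>i<length vs. \<nu> i * (vs ! i) k) = 0)
      \<Longrightarrow> \<forall>i<length vs. \<nu> i = 0"
  shows "\<exists>cs s. length cs = length vs \<and> set cs \<subseteq> {..Suc j} \<and> s \<noteq> 0 \<and>
    (\<forall>u \<nu>. (\<forall>i. i \<notin> I \<longrightarrow> \<nu> i = 0) \<longrightarrow> (\<forall>k\<le>j. u k = (\<Sum>i<length vs. \<nu> i * (vs ! i) k)) \<longrightarrow>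
       reduce j (zip vs cs) u (Suc j) = s * (u (Suc j) - (\<Sum>i<length vs. \<nu> i * (vs ! i) (Suc j))))"
  using assms
proof (induction "length vs" arbitrary: vs I)
  case 0
  then show ?case by (intro exI[of _ "[]"] exI[of _ 1]) simp
next
  case (Suc n)
  then obtain v ws where vs: "vs = v # ws" "length ws = n" by (metis length_Suc_conv)
  let ?I = "{i. Suc i \<in> I}"
  have split: "(\<Sum>i<length vs. \<nu> i * (vs ! i) k) = \<nu> 0 * v k + (\<Sum>i<n. \<nu> (Suc i) * (ws ! i) k)" for \<nu> k
    by (simp add: vs sum.lessThan_Suc_shift del: sum.lessThan_Suc)
  have len: "length vs = Suc n" using vs by simp
  show ?case
  proof (cases "0 \<in> I")
    case False
    have "\<exists>cs s. length cs = length ws \<and> set cs \<subseteq> {..Suc j} \<and> s \<noteq> 0 \<and>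
      (\<forall>u \<nu>. (\<forall>i. i \<notin> ?I \<longrightarrow> \<nu> i = 0) \<longrightarrow> (\<forall>k\<le>j. u k = (\<Sum>i<length ws. \<nu> i * (ws ! i) k)) \<longrightarrow>
       reduce j (zip ws cs) u (Suc j) = s * (u (Suc j) - (\<Sum>i<length ws. \<nu> i * (ws ! i) (Suc j))))"
    proof (rule Suc.hyps(1))
      fix \<nu> assume \<nu>: "\<forall>i. i \<notin> ?I \<longrightarrow> \<nu> i = 0" "\<forall>k\<le>j. (\<Sum>i<length ws. \<nu> i * (ws ! i) k) = 0"
      define \<xi> where "\<xi> = (\<lambda>i. case i of 0 \<Rightarrow> 0 | Suc i \<Rightarrow> \<nu> i)"
      have "\<forall>i<length vs. \<xi> i = 0"
      proof (rule Suc.prems)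
        show "\<forall>i. i \<notin> I \<longrightarrow> \<xi> i = 0" using \<nu>(1) by (auto simp: \<xi>_def split: nat.split)
        show "\<forall>k\<le>j. (\<Sum>i<length vs. \<xi> i * (vs ! i) k) = 0"
          unfolding split using \<nu>(2) vs(2) by (simp add: \<xi>_def)
      qed
      then have "\<xi> (Suc i) = 0" if "i < n" for i using that len by auto
      then show "\<forall>i<length ws. \<nu> i = 0" using vs(2) by (simp add: \<xi>_def)
    qed (simp add: vs)
    then obtain cs s where cs: "length cs = length ws" "set cs \<subseteq> {..Suc j}" "s \<noteq> 0"
      "\<And>u \<nu>. (\<forall>i. i \<notin> ?I \<longrightarrow> \<nu> i = 0) \<Longrightarrow> (\<forall>k\<le>j. u k = (\<Sum>i<length ws. \<nu> i * (ws ! i) k)) \<Longrightarrow>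
       reduce j (zip ws cs) u (Suc j) = s * (u (Suc j) - (\<Sum>i<length ws. \<nu> i * (ws ! i) (Suc j)))"
      by blast
    \<comment> \<open>The pivot \<open>Suc j\<close> exceeds \<open>j\<close> and thus marks the
      first vector, which is outside \<open>I\<close>, as skipped.\<close>
    show ?thesis
    proof (intro exI[of _ "Suc j # cs"] exI[of _ s] conjI allI impI)
      fix u \<nu> assume \<nu>: "\<forall>i. i \<notin> I \<longrightarrow> \<nu> i = 0" "\<forall>k\<le>j. u k = (\<Sum>i<length vs. \<nu> i * (vs ! i) k)"
      have "\<nu> 0 = 0" using \<nu>(1) False by blast
      then show "reduce j (zip vs (Suc j # cs)) u (Suc j)
          = s * (u (Suc j) - (\<Sum>i<length vs. \<nu> i * (vs ! i) (Suc j)))"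
        using cs(4)[of "\<lambda>i. \<nu> (Suc i)" u] \<nu> vs(2) unfolding split by (simp add: vs(1))
    qed (use cs vs in auto)
  next
    case True
    \<comment> \<open>A vector from \<open>I\<close> that vanished in all coordinates up to
      \<open>j\<close> would be dependent on its own.\<close>
    obtain c where c: "c \<le> j" "v c \<noteq> 0"
    proof (rule ccontr)
      assume "\<not> thesis"
      then have v0: "\<And>c. c \<le> j \<Longrightarrow> v c = 0" using that by blast
      define \<xi> :: "nat \<Rightarrow> real" where "\<xi> = (\<lambda>i. if i = 0 then 1 else 0)"
      have "\<forall>i<length vs. \<xi> i = 0"
      proof (rule Suc.prems)
        show "\<forall>i. i \<notin> I \<longrightarrow> \<xi> i = 0" using True by (auto simp: \<xi>_def)
        show "\<forall>k\<le>j. (\<Sum>i<length vs. \<xi> i * (vs ! i) k) = 0"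
          unfolding split using v0 by (simp add: \<xi>_def)
      qed
      then show False using len by (auto simp: \<xi>_def)
    qed
    define ws' where "ws' = map (elim_coord c v) ws"
    have ws': "length ws' = n" "\<And>i k. i < n \<Longrightarrow> (ws' ! i) k = v c * (ws ! i) k - (ws ! i) c * v k"
      using vs by (auto simp: ws'_def elim_coord_def)
    have sum': "(\<Sum>i<n. \<nu> i * (ws' ! i) k) = v c * (\<Sum>i<n. \<nu> i * (ws ! i) k) - (\<Sum>i<n. \<nu> i * (ws ! i) c) * v k" for \<nu> k
      by (simp add: ws' algebra_simps sum_subtractf sum_distrib_left)
    have "\<exists>cs s. length cs = length ws' \<and> set cs \<subseteq> {..Suc j} \<and> s \<noteq> 0 \<and>
      (\<forall>u \<nu>. (\<forall>i. i \<notin> ?I \<longrightarrow> \<nu> i = 0) \<longrightarrow> (\<forall>k\<le>j. u k = (\<Sum>i<length ws'. \<nu> i * (ws' ! i) k)) \<longrightarrow>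
       reduce j (zip ws' cs) u (Suc j) = s * (u (Suc j) - (\<Sum>i<length ws'. \<nu> i * (ws' ! i) (Suc j))))"
    proof (rule Suc.hyps(1))
      fix \<nu> assume \<nu>: "\<forall>i. i \<notin> ?I \<longrightarrow> \<nu> i = 0" "\<forall>k\<le>j. (\<Sum>i<length ws'. \<nu> i * (ws' ! i) k) = 0"
      \<comment> \<open>A dependence of the eliminated vectors is pulled back: \<open>v\<close>
        receives what elimination subtracted, and the other coefficients are scaled by
        \<open>v c\<close>.\<close>
      define \<xi> where "\<xi> = (\<lambda>i. case i of 0 \<Rightarrow> - (\<Sum>i<n. \<nu> i * (ws ! i) c) | Suc i \<Rightarrow> v c * \<nu> i)"
      have "\<forall>i<length vs. \<xi> i = 0"
      proof (rule Suc.prems)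
        show "\<forall>i. i \<notin> I \<longrightarrow> \<xi> i = 0" using \<nu>(1) True by (auto simp: \<xi>_def split: nat.split)
        have "(\<Sum>i<length vs. \<xi> i * (vs ! i) k) = (\<Sum>i<n. \<nu> i * (ws' ! i) k)" for k
          unfolding split sum' by (simp add: \<xi>_def sum_distrib_left mult_ac)
        then show "\<forall>k\<le>j. (\<Sum>i<length vs. \<xi> i * (vs ! i) k) = 0" using \<nu>(2) ws'(1) by simp
      qed
      then have "\<xi> (Suc i) = 0" if "i < n" for i using that len by auto
      then show "\<forall>i<length ws'. \<nu> i = 0" using c(2) ws'(1) by (simp add: \<xi>_def)
    qed (simp add: ws')
    then obtain cs s where cs: "length cs = length ws'" "set cs \<subseteq> {..Suc j}" "s \<noteq> 0"
      "\<And>u \<nu>. (\<forall>i. i \<notin> ?I \<longrightarrow> \<nu> i = 0) \<Longrightarrow> (\<forall>k\<le>j. u k = (\<Sum>i<length ws'. \<nu> i * (ws' ! i) k)) \<Longrightarrow>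
       reduce j (zip ws' cs) u (Suc j) = s * (u (Suc j) - (\<Sum>i<length ws'. \<nu> i * (ws' ! i) (Suc j)))"
      by blast
    show ?thesis
    proof (intro exI[of _ "c # cs"] exI[of _ "s * v c"] conjI allI impI)
      fix u \<nu> assume \<nu>: "\<forall>i. i \<notin> I \<longrightarrow> \<nu> i = 0" "\<forall>k\<le>j. u k = (\<Sum>i<length vs. \<nu> i * (vs ! i) k)"
      let ?S = "\<lambda>k. \<Sum>i<n. \<nu> (Suc i) * (ws ! i) k"
      have u: "u k = \<nu> 0 * v k + ?S k" if "k \<le> j" for k using \<nu>(2) that unfolding split by blast
      have zip: "map (map_prod (elim_coord c v) id) (zip ws cs) = zip ws' cs"
        by (simp add: ws'_def zip_map1 map_prod_def)
      have "reduce j (zip vs (c # cs)) u (Suc j) = reduce j (zip ws' cs) (elim_coord c v u) (Suc j)"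
        using c(1) by (simp add: vs zip)
      also have "\<dots> = s * (elim_coord c v u (Suc j) - (\<Sum>i<n. \<nu> (Suc i) * (ws' ! i) (Suc j)))"
        using cs(4)[of "\<lambda>i. \<nu> (Suc i)" "elim_coord c v u"] \<nu>(1) ws'(1) unfolding sum'
        by (simp add: elim_coord_def u c(1) sum' algebra_simps)
      also have "elim_coord c v u (Suc j) - (\<Sum>i<n. \<nu> (Suc i) * (ws' ! i) (Suc j))
          = v c * (u (Suc j) - (\<nu> 0 * v (Suc j) + ?S (Suc j)))"
        unfolding sum' elim_coord_def u[OF c(1)] by (simp add: algebra_simps)
      finally show "reduce j (zip vs (c # cs)) u (Suc j)
          = s * v c * (u (Suc j) - (\<Sum>i<length vs. \<nu> i * (vs ! i) (Suc j)))"
        unfolding split by (simp add: mult.assoc)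
    qed (use cs c vs ws' in auto)
  qed
qed

lemma in_cone_cong:
  assumes "\<And>i k. i \<in> S \<Longrightarrow> k \<le> j \<Longrightarrow> v i k = v' i k" "\<And>k. k \<le> j \<Longrightarrow> a k = a' k"
  shows "in_cone v S j a \<longleftrightarrow> in_cone v' S j a'"
  using assms by (simp add: in_cone_def cong: conj_cong)

lemma in_cone_reindex:
  assumes "inj_on f S"
  shows "in_cone (\<lambda>i. v (f i)) S j a \<longleftrightarrow> in_cone v (f ` S) j a"
proof
  assume "in_cone v (f ` S) j a"
  then obtain \<mu> where \<mu>: "\<forall>i\<in>f ` S. 0 \<le> \<mu> i" "\<forall>k\<le>j. (\<Sum>i\<in>f ` S. \<mu> i * v i k) = a k"
    by (auto simp: in_cone_def)
  then show "in_cone (\<lambda>i. v (f i)) S j a" unfolding in_cone_def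
    by (intro exI[of _ "\<mu> \<circ> f"]) (simp add: sum.reindex[OF assms] o_def)
next
  assume "in_cone (\<lambda>i. v (f i)) S j a"
  then obtain \<mu> where \<mu>: "\<forall>i\<in>S. 0 \<le> \<mu> i" "\<forall>k\<le>j. (\<Sum>i\<in>S. \<mu> i * v (f i) k) = a k"
    by (auto simp: in_cone_def)
  then show "in_cone v (f ` S) j a" unfolding in_cone_def
    by (intro exI[of _ "\<mu> \<circ> inv_into S f"]) (simp add: sum.reindex[OF assms] assms)
qed

section \<open>Tuples whose hull meets a flat\<close>

text \<open>The witness is the least attained value with at least a third of the family at or below
  it. The largest value strictly below it fails this condition, which bounds the strict count even
  when values coincide.\<close>

lemma exists_lower_tertile:
  fixes y :: "'a \<Rightarrow> real"
  assumes H: "finite H" "H \<noteq> {}"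
  shows "\<exists>u. 3 * card {h \<in> H. y h < u} < card H \<and> card H \<le> 3 * card {h \<in> H. y h \<le> u}"
proof -
  define W where "W = {h \<in> H. card H \<le> 3 * card {h' \<in> H. y h' \<le> y h}}"
  obtain g where g: "g \<in> H" "\<And>h. h \<in> H \<Longrightarrow> y h \<le> y g"
    using that[OF arg_min_if_finite(1)[OF H, of "\<lambda>h. - y h"]] arg_min_least[OF H, of _ "\<lambda>h. - y h"] by simp
  have "{h' \<in> H. y h' \<le> y g} = H" using g by auto
  then have "g \<in> W" using g by (simp add: W_def)
  then have W: "finite W" "W \<noteq> {}" using H by (auto simp: W_def)
  obtain w where w: "w \<in> W" "\<And>h. h \<in> W \<Longrightarrow> y w \<le> y h"
    using that[OF arg_min_if_finite(1)[OF W] arg_min_least[OF W]] .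
  have "3 * card {h \<in> H. y h < y w} < card H"
  proof (cases "{h \<in> H. y h < y w} = {}")
    case True
    show ?thesis unfolding True using H by (simp add: card_gt_0_iff)
  next
    case False
    have fin: "finite {h \<in> H. y h < y w}" using H by simp
    obtain q where q: "q \<in> {h \<in> H. y h < y w}" "\<And>h. h \<in> {h \<in> H. y h < y w} \<Longrightarrow> y h \<le> y q"
      using that[OF arg_min_if_finite(1)[OF fin False, of "\<lambda>h. - y h"]]
        arg_min_least[OF fin False, of _ "\<lambda>h. - y h"] by simp
    then have "q \<notin> W" using w(2)[of q] by auto
    then have "3 * card {h \<in> H. y h \<le> y q} < card H" using q(1) by (simp add: W_def)
    moreover have "card {h \<in> H. y h < y w} \<le> card {h \<in> H. y h \<le> y q}"
      using H q(2) by (intro card_mono) auto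
    ultimately show ?thesis by linarith
  qed
  then show ?thesis using w(1) by (intro exI[of _ "y w"]) (simp add: W_def)
qed

text \<open>The upper end is the lower tertile of \<open>- y\<close>. Fewer than a third of the
  values lie below \<open>u\<close> and fewer than a third above \<open>v\<close>, so at least a
  third remains in between.\<close>

lemma exists_middle_third:
  fixes y :: "'a \<Rightarrow> real"
  assumes H: "finite H" "H \<noteq> {}"
  shows "\<exists>u v. card H \<le> 3 * card {h \<in> H. u \<le> y h \<and> y h \<le> v} \<and>
    (\<forall>z. u \<le> z \<longrightarrow> z \<le> v \<longrightarrow>
       card H \<le> 3 * card {h \<in> H. y h \<le> z} \<and> card H \<le> 3 * card {h \<in> H. z \<le> y h})"
proof -
  obtain u where u: "3 * card {h \<in> H. y h < u} < card H" "card H \<le> 3 * card {h \<in> H. y h \<le> u}"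
    using exists_lower_tertile[OF H] by blast
  obtain v' where v': "3 * card {h \<in> H. - y h < v'} < card H" "card H \<le> 3 * card {h \<in> H. - y h \<le> v'}"
    using exists_lower_tertile[OF H, of "\<lambda>h. - y h"] by blast
  define v where "v = - v'"
  have v: "3 * card {h \<in> H. v < y h} < card H" "card H \<le> 3 * card {h \<in> H. v \<le> y h}"
    using v' by (simp_all add: v_def minus_less_iff minus_le_iff)
  show ?thesis
  proof (rule exI[of _ u], rule exI[of _ v], intro conjI allI impI)
    have "H = {h \<in> H. y h < u} \<union> {h \<in> H. v < y h} \<union> {h \<in> H. u \<le> y h \<and> y h \<le> v}" by auto
    then have "card H \<le> card {h \<in> H. y h < u} + card {h \<in> H. v < y h} + card {h \<in> H. u \<le> y h \<and> y h \<le> v}"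
      by (metis (no_types, lifting) add_le_mono1 card_Un_le order_trans)
    then show "card H \<le> 3 * card {h \<in> H. u \<le> y h \<and> y h \<le> v}" using u(1) v(1) by linarith
  next
    fix z assume z: "u \<le> z" "z \<le> v"
    have "card {h \<in> H. y h \<le> u} \<le> card {h \<in> H. y h \<le> z}" using H z by (intro card_mono) auto
    then show "card H \<le> 3 * card {h \<in> H. y h \<le> z}" using u(2) by linarith
    have "card {h \<in> H. v \<le> y h} \<le> card {h \<in> H. z \<le> y h}" using H z by (intro card_mono) auto
    then show "card H \<le> 3 * card {h \<in> H. z \<le> y h}" using v(2) by linarith
  qed
qed

text \<open>Lists with repetitions allowed make the number of tuples exactly
  \<open>card Q ^ n\<close>, so fractions of tuples compare across levels without binomial
  coefficients.\<close>

definition tuples :: "'p set \<Rightarrow> nat \<Rightarrow> 'p list set" where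
  "tuples Q n = {T. set T \<subseteq> Q \<and> length T = n}"

lemma finite_tuples: "finite Q \<Longrightarrow> finite (tuples Q n)"
  by (simp add: tuples_def finite_lists_length_eq)

lemma card_tuples: "finite Q \<Longrightarrow> card (tuples Q n) = card Q ^ n"
  by (simp add: tuples_def card_lists_length_eq)

text \<open>For \<open>x p 0 = 1 = a 0\<close>, the tuples of points whose convex hull meets the flat on which the
  coordinates \<open>1, \<dots>, j\<close> are \<open>a 1, \<dots>, a j\<close>.\<close>

definition hitting :: "('p \<Rightarrow> nat \<Rightarrow> real) \<Rightarrow> 'p set \<Rightarrow> nat \<Rightarrow> (nat \<Rightarrow> real) \<Rightarrow> 'p list set" where
  "hitting x Q j a = {T \<in> tuples Q (Suc j). in_cone (\<lambda>i. x (T ! i)) {..<Suc j} j a}"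

text \<open>The cone of the \<open>2 * Suc j\<close> entries of both tuples contains
  \<open>a\<close>, and Caratheodory in the \<open>j + 2\<close> coordinates from 0 to
  \<open>Suc j\<close> keeps at most \<open>j + 2\<close> of them. Positions rather than points are
  selected, since entries may repeat.\<close>

lemma exists_hitting_subtuple:
  assumes T: "T \<in> tuples Q (Suc j)" "in_cone (\<lambda>i. x (T ! i)) {..<Suc j} (Suc j) (a(Suc j := y))" "y \<le> a (Suc j)"
    and T': "T' \<in> tuples Q (Suc j)" "in_cone (\<lambda>i. x (T' ! i)) {..<Suc j} (Suc j) (a(Suc j := y'))" "a (Suc j) \<le> y'"
  shows "\<exists>I\<subseteq>{..<2 * Suc j}. card I = Suc (Suc j) \<and>
     map ((!) (T @ T')) (sorted_list_of_set I) \<in> hitting x Q (Suc j) a"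
proof -
  define Z where "Z = T @ T'"
  have len: "length T = Suc j" "length T' = Suc j" "length Z = 2 * Suc j"
    using T(1) T'(1) by (auto simp: tuples_def Z_def)
  have Z: "set Z \<subseteq> Q" using T(1) T'(1) by (auto simp: tuples_def Z_def)
  have left: "in_cone (\<lambda>i. x (Z ! i)) {..<Suc j} (Suc j) (a(Suc j := y))"
    using T(2) by (rule in_cone_cong[THEN iffD1, rotated 2]) (auto simp: Z_def len nth_append)
  let ?f = "\<lambda>i. Suc j + i"
  have "in_cone (\<lambda>i. x (Z ! ?f i)) {..<Suc j} (Suc j) (a(Suc j := y'))"
    using T'(2) by (rule in_cone_cong[THEN iffD1, rotated 2]) (auto simp: Z_def len nth_append)
  then have right: "in_cone (\<lambda>i. x (Z ! i)) (?f ` {..<Suc j}) (Suc j) (a(Suc j := y'))"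
    by (subst (asm) in_cone_reindex[where v = "\<lambda>i. x (Z ! i)"]) auto
  have "in_cone (\<lambda>i. x (Z ! i)) ({..<Suc j} \<union> ?f ` {..<Suc j}) (Suc j) a"
    by (rule in_cone_extend[OF _ _ _ left right T(3) T'(3)]) auto
  then have "in_cone (\<lambda>i. x (Z ! i)) {..<2 * Suc j} (Suc j) a"
    by (rule in_cone_mono) auto
  then obtain I0 where I0: "I0 \<subseteq> {..<2 * Suc j}" "in_cone (\<lambda>i. x (Z ! i)) I0 (Suc j) a"
      "indep_upto (\<lambda>i. x (Z ! i)) I0 (Suc j)"
    using conic_caratheodory[of "{..<2 * Suc j}"] by blast
  have "card I0 \<le> Suc (Suc j)" using I0 by (intro card_indep_upto_le) (auto intro: finite_subset)
  \<comment> \<open>Extra positions can carry weight 0, and the counting needs a fixed size.\<close>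
  then obtain I where I: "I0 \<subseteq> I" "I \<subseteq> {..<2 * Suc j}" "card I = Suc (Suc j)"
    using exists_subset_between[of I0 "Suc (Suc j)" "{..<2 * Suc j}"] I0(1) by auto
  have finI: "finite I" using I(2) by (rule finite_subset) simp
  define l where "l = sorted_list_of_set I"
  have l: "distinct l" "set l = I" "length l = Suc (Suc j)"
    using finI I(3) by (auto simp: l_def)
  have "in_cone (\<lambda>i. x (Z ! i)) I (Suc j) a" using I0(2) I(1) finI by (rule in_cone_mono)
  also have "I = (!) l ` {..<Suc (Suc j)}" using l by (auto simp: set_conv_nth)
  finally have "in_cone (\<lambda>i. x (Z ! (l ! i))) {..<Suc (Suc j)} (Suc j) a"
    by (subst in_cone_reindex[where v = "\<lambda>i. x (Z ! i)"]) (use l in \<open>auto intro!: inj_on_nth\<close>)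
  then have "in_cone (\<lambda>i. x (map ((!) Z) l ! i)) {..<Suc (Suc j)} (Suc j) a"
    by (rule in_cone_cong[THEN iffD1, rotated 2]) (auto simp: l)
  moreover have "map ((!) Z) l \<in> tuples Q (Suc (Suc j))"
  proof -
    have "Z ! i \<in> Q" if "i \<in> I" for i
    proof -
      have "i < length Z" using that I(2) len(3) by auto
      then show ?thesis using Z nth_mem by blast
    qed
    then show ?thesis using l by (auto simp: tuples_def)
  qed
  ultimately show ?thesis using I unfolding Z_def l_def hitting_def by blast
qed

text \<open>A pair of tuples is recovered from the set of selected positions, the hitting subtuple
  found there and the remaining entries. There are \<open>4 ^ Suc j\<close> position sets, and
  \<open>2 * (j + 1) - (j + 2) = j\<close> entries remain, whence \<open>card Q ^ j\<close>.\<close>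

lemma card_hitting_Suc_ge:
  assumes Q: "finite Q" and A: "A \<subseteq> tuples Q (Suc j)" and A': "A' \<subseteq> tuples Q (Suc j)"
    and below: "\<And>T. T \<in> A \<Longrightarrow> \<exists>y\<le>a (Suc j). in_cone (\<lambda>i. x (T ! i)) {..<Suc j} (Suc j) (a(Suc j := y))"
    and above: "\<And>T. T \<in> A' \<Longrightarrow> \<exists>y\<ge>a (Suc j). in_cone (\<lambda>i. x (T ! i)) {..<Suc j} (Suc j) (a(Suc j := y))"
  shows "card A * card A' \<le> 4 ^ Suc j * card Q ^ j * card (hitting x Q (Suc j) a)"
proof -
  let ?U = "{..<2 * Suc j}"
  have ex: "\<exists>I. I \<subseteq> ?U \<and> card I = Suc (Suc j) \<and>
     map ((!) (T @ T')) (sorted_list_of_set I) \<in> hitting x Q (Suc j) a" if TT: "T \<in> A" "T' \<in> A'" for T T'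
  proof -
    obtain y y' where "y \<le> a (Suc j)" "in_cone (\<lambda>i. x (T ! i)) {..<Suc j} (Suc j) (a(Suc j := y))"
      "a (Suc j) \<le> y'" "in_cone (\<lambda>i. x (T' ! i)) {..<Suc j} (Suc j) (a(Suc j := y'))"
      using below[OF TT(1)] above[OF TT(2)] by blast
    then show ?thesis using exists_hitting_subtuple[of T Q j x a y T' y'] TT A A' by blast
  qed
  then obtain I where I: "\<And>T T'. T \<in> A \<Longrightarrow> T' \<in> A' \<Longrightarrow> I T T' \<subseteq> ?U \<and> card (I T T') = Suc (Suc j) \<and>
     map ((!) (T @ T')) (sorted_list_of_set (I T T')) \<in> hitting x Q (Suc j) a"
    by metis
  define \<phi> where "\<phi> = (\<lambda>(T, T'). (I T T', map ((!) (T @ T')) (sorted_list_of_set (I T T')),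
      map ((!) (T @ T')) (sorted_list_of_set (?U - I T T'))))"
  have fin: "finite (I T T')" if "T \<in> A" "T' \<in> A'" for T T'
    using I[OF that] by (auto intro: finite_subset)
  have "inj_on \<phi> (A \<times> A')"
  proof (rule inj_onI, clarify)
    fix T T' S S' assume TS: "T \<in> A" "T' \<in> A'" "S \<in> A" "S' \<in> A'" and eq: "\<phi> (T, T') = \<phi> (S, S')"
    have len: "length T = Suc j" "length S = Suc j" "length T' = Suc j" "length S' = Suc j"
      using TS A A' by (auto simp: tuples_def)
    have "(T @ T') ! i = (S @ S') ! i" if "i \<in> ?U" for i
      using eq that fin[OF TS(1,2)] by (cases "i \<in> I T T'") (auto simp: \<phi>_def)
    then have "T @ T' = S @ S'" by (intro nth_equalityI) (auto simp: len)
    then show "T = S \<and> T' = S'" using len by auto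
  qed
  moreover have "\<phi> ` (A \<times> A') \<subseteq> Pow ?U \<times> hitting x Q (Suc j) a \<times> tuples Q j"
  proof (rule image_subsetI)
    fix z assume "z \<in> A \<times> A'"
    then obtain T T' where z: "z = (T, T')" "T \<in> A" "T' \<in> A'" by auto
    have "(T @ T') ! i \<in> Q" if "i \<in> ?U" for i
    proof -
      have "T \<in> tuples Q (Suc j)" "T' \<in> tuples Q (Suc j)" using z A A' by auto
      then have "length (T @ T') = 2 * Suc j" "set (T @ T') \<subseteq> Q" by (auto simp: tuples_def)
      then show ?thesis using that nth_mem[of i "T @ T'"] by auto
    qed
    moreover have "card (?U - I T T') = j"
      using I[OF z(2,3)] fin[OF z(2,3)] by (subst card_Diff_subset) auto
    ultimately have "map ((!) (T @ T')) (sorted_list_of_set (?U - I T T')) \<in> tuples Q j"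
      by (auto simp: tuples_def)
    then show "\<phi> z \<in> Pow ?U \<times> hitting x Q (Suc j) a \<times> tuples Q j"
      using I[OF z(2,3)] by (simp add: \<phi>_def z(1))
  qed
  moreover have "finite (Pow ?U \<times> hitting x Q (Suc j) a \<times> tuples Q j)"
    using Q by (auto simp: hitting_def finite_tuples)
  ultimately have "card (A \<times> A') \<le> card (Pow ?U \<times> hitting x Q (Suc j) a \<times> tuples Q j)"
    by (rule card_inj_on_le)
  also have "\<dots> = 2 ^ (2 * Suc j) * (card (hitting x Q (Suc j) a) * card Q ^ j)"
    using Q by (simp only: card_cartesian_product card_Pow finite_lessThan card_lessThan card_tuples)
  also have "(2::nat) ^ (2 * Suc j) = 4 ^ Suc j" by (simp only: power_mult) simp
  finally show ?thesis by (simp only: card_cartesian_product mult_ac)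
qed

section \<open>Fixing one coordinate after the other\<close>

text \<open>Homogeneous coordinates: coordinate \<open>0\<close> is a common denominator of the others.\<close>

definition dehom :: "(nat \<Rightarrow> real poly) \<Rightarrow> real \<Rightarrow> nat \<Rightarrow> real" where
  "dehom w t k = poly (w k) t / poly (w 0) t"

text \<open>With suitable pivots, reducing the unit vector \<open>Suc j\<close> returns the factor
  \<open>s\<close> of \<open>exists_pivots\<close>, and reducing \<open>w\<close> with last
  coordinate 0 returns \<open>- s\<close> times the sought coordinate, still scaled by
  \<open>w 0\<close>. Multiplying the old coordinates by \<open>s\<close> leaves their quotients by
  coordinate 0 unchanged and makes the new quotient the sought coordinate.\<close>

definition next_flat ::
    "('p \<Rightarrow> nat \<Rightarrow> real poly) \<Rightarrow> nat \<Rightarrow> (nat \<Rightarrow> real poly) \<Rightarrow> ('p \<times> nat) list \<Rightarrow> nat \<Rightarrow> real poly" where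
  "next_flat V j w L k =
     (if k \<le> j then reduce j (map (map_prod V id) L) (\<lambda>k. if k = Suc j then 1 else 0) (Suc j) * w k
      else - reduce j (map (map_prod V id) L) (w(Suc j := 0)) (Suc j))"

lemma degree_next_flat_le:
  assumes "\<And>k. k \<le> j \<Longrightarrow> degree (w k) \<le> D"
    and "\<And>p c k. (p, c) \<in> set L \<Longrightarrow> k \<le> Suc j \<Longrightarrow> degree (V p k) \<le> D"
    and "length L = Suc j"
  shows "degree (next_flat V j w L k) \<le> (2 ^ Suc j + 1) * D"
proof -
  have red: "degree (reduce j (map (map_prod V id) L) u (Suc j)) \<le> 2 ^ Suc j * D"
    if "\<And>k. k \<le> Suc j \<Longrightarrow> degree (u k) \<le> D" for u
  proof -
    have "degree (reduce j (map (map_prod V id) L) u (Suc j)) \<le> 2 ^ length (map (map_prod V id) L) * D"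
      by (rule degree_reduce_le) (use that assms(2) in auto)
    then show ?thesis by (simp only: length_map assms(3))
  qed
  show ?thesis
  proof (cases "k \<le> j")
    case True
    have "degree (reduce j (map (map_prod V id) L) (\<lambda>k. if k = Suc j then 1 else 0) (Suc j)) \<le> 2 ^ Suc j * D"
      by (rule red) auto
    then have "degree (next_flat V j w L k) \<le> 2 ^ Suc j * D + D"
      unfolding next_flat_def using True assms(1)[OF True]
      by (simp del: power_Suc) (meson add_mono degree_mult_le order_trans)
    then show ?thesis by (simp only: add_mult_distrib mult_1)
  next
    case False
    have "degree (reduce j (map (map_prod V id) L) (w(Suc j := 0)) (Suc j)) \<le> 2 ^ Suc j * D"
      by (rule red) (use assms(1) in \<open>auto simp: le_Suc_eq\<close>)
    then show ?thesis using False by (simp add: next_flat_def add_mult_distrib)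
  qed
qed

lemma dehom_next_flat:
  assumes "poly (next_flat V j w L 0) t \<noteq> 0" "k \<le> j"
  shows "dehom (next_flat V j w L) t k = dehom w t k"
  using assms by (auto simp: dehom_def next_flat_def)

text \<open>The tuple may be dependent at time \<open>t\<close>. Caratheodory provides an
  independent part \<open>I\<close> whose cone still contains the flat, and the pivots skip the
  rest; this is why the pivot sequence varies with \<open>t\<close>.\<close>

lemma exists_next_flat:
  assumes V0: "\<And>p. p \<in> set T \<Longrightarrow> poly (V p 0) t \<noteq> 0" and w0: "poly (w 0) t \<noteq> 0"
    and len: "length T = Suc j"
    and cone: "in_cone (\<lambda>i. dehom (V (T ! i)) t) {..<Suc j} j (dehom w t)"
  shows "\<exists>cs. length cs = Suc j \<and> set cs \<subseteq> {..Suc j} \<and> poly (next_flat V j w (zip T cs) 0) t \<noteq> 0 \<and>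
     in_cone (\<lambda>i. dehom (V (T ! i)) t) {..<Suc j} (Suc j) (dehom (next_flat V j w (zip T cs)) t)"
proof -
  define x where "x = (\<lambda>i. dehom (V (T ! i)) t)"
  define D where "D = (\<lambda>i. poly (V (T ! i) 0) t)"
  have D: "D i \<noteq> 0" if "i < Suc j" for i using V0 that len by (simp add: D_def)
  define vs where "vs = map (\<lambda>p k. poly (V p k) t) T"
  have lenvs: "length vs = Suc j" by (simp add: vs_def len)
  have vs: "(vs ! i) k = D i * x i k" if "i < Suc j" for i k
    using D[OF that] that len by (simp add: vs_def x_def dehom_def D_def)
  obtain I where I: "I \<subseteq> {..<Suc j}" "in_cone x I j (dehom w t)" "indep_upto x I j"
    using conic_caratheodory[OF _ cone] by (auto simp: x_def)
  have finI: "finite I" using I(1) by (rule finite_subset) simp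
  have sumI: "(\<Sum>i<length vs. \<nu> i * (vs ! i) k) = (\<Sum>i\<in>I. \<nu> i * D i * x i k)"
    if "\<forall>i. i \<notin> I \<longrightarrow> \<nu> i = 0" for \<nu> k
  proof -
    have "(\<Sum>i<length vs. \<nu> i * (vs ! i) k) = (\<Sum>i<Suc j. \<nu> i * D i * x i k)"
      unfolding lenvs by (intro sum.cong) (auto simp: vs)
    also have "\<dots> = (\<Sum>i\<in>I. \<nu> i * D i * x i k)"
      by (rule sum.mono_neutral_right) (use I(1) that in auto)
    finally show ?thesis .
  qed
  have "\<exists>cs s. length cs = length vs \<and> set cs \<subseteq> {..Suc j} \<and> s \<noteq> 0 \<and>
    (\<forall>u \<nu>. (\<forall>i. i \<notin> I \<longrightarrow> \<nu> i = 0) \<longrightarrow> (\<forall>k\<le>j. u k = (\<Sum>i<length vs. \<nu> i * (vs ! i) k)) \<longrightarrow>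
       reduce j (zip vs cs) u (Suc j) = s * (u (Suc j) - (\<Sum>i<length vs. \<nu> i * (vs ! i) (Suc j))))"
  proof (rule exists_pivots)
    fix \<nu> assume \<nu>: "\<forall>i. i \<notin> I \<longrightarrow> \<nu> i = 0" "\<forall>k\<le>j. (\<Sum>i<length vs. \<nu> i * (vs ! i) k) = 0"
    have "\<forall>k\<le>j. (\<Sum>i\<in>I. (\<nu> i * D i) * x i k) = 0" using \<nu>(2) unfolding sumI[OF \<nu>(1)] .
    then have "\<forall>i\<in>I. \<nu> i * D i = 0" using I(3) by (auto simp: indep_upto_def dest!: spec[of _ "\<lambda>i. \<nu> i * D i"])
    then show "\<forall>i<length vs. \<nu> i = 0" using D I(1) \<nu>(1) unfolding lenvs by fastforce
  qed
  then obtain cs s where cs: "length cs = Suc j" "set cs \<subseteq> {..Suc j}" "s \<noteq> 0"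
    and red: "\<And>u \<nu>. (\<forall>i. i \<notin> I \<longrightarrow> \<nu> i = 0) \<Longrightarrow> (\<forall>k\<le>j. u k = (\<Sum>i<length vs. \<nu> i * (vs ! i) k)) \<Longrightarrow>
       reduce j (zip vs cs) u (Suc j) = s * (u (Suc j) - (\<Sum>i<length vs. \<nu> i * (vs ! i) (Suc j)))"
    unfolding lenvs by blast
  have zip: "map (map_prod (\<lambda>v k. poly (v k) t) id) (map (map_prod V id) (zip T cs)) = zip vs cs"
    by (simp add: vs_def zip_map1 map_prod_def case_prod_beta o_def)
  \<comment> \<open>All coordinates of the unit vector up to \<open>j\<close> vanish, so zero
    coefficients apply and the bare factor \<open>s\<close> is left.\<close>
  have unit: "poly (reduce j (map (map_prod V id) (zip T cs)) (\<lambda>k. if k = Suc j then 1 else 0) (Suc j)) t = s"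
    unfolding poly_reduce zip using red[of "\<lambda>_. 0" "\<lambda>k. poly (if k = Suc j then 1 else 0) t"] by simp
  obtain \<mu> where \<mu>: "\<forall>i\<in>I. 0 \<le> \<mu> i" "\<forall>k\<le>j. (\<Sum>i\<in>I. \<mu> i * x i k) = dehom w t k"
    using I(2) by (auto simp: in_cone_def)
  \<comment> \<open>The weights \<mu> refer to vectors normalised by their coordinate 0; dividing by
    \<open>D i\<close> and multiplying by \<open>poly (w 0) t\<close> adapts them to the polynomial
    vectors.\<close>
  define \<nu> where "\<nu> = (\<lambda>i. if i \<in> I then poly (w 0) t * \<mu> i / D i else 0)"
  have \<nu>: "(\<Sum>i<length vs. \<nu> i * (vs ! i) k) = poly (w 0) t * (\<Sum>i\<in>I. \<mu> i * x i k)" for k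
  proof -
    have "(\<Sum>i<length vs. \<nu> i * (vs ! i) k) = (\<Sum>i\<in>I. \<nu> i * D i * x i k)"
      by (rule sumI) (simp add: \<nu>_def)
    also have "\<dots> = (\<Sum>i\<in>I. poly (w 0) t * (\<mu> i * x i k))"
      using D I(1) by (intro sum.cong) (auto simp: \<nu>_def)
    finally show ?thesis by (simp add: sum_distrib_left)
  qed
  have last: "poly (reduce j (map (map_prod V id) (zip T cs)) (w(Suc j := 0)) (Suc j)) t
      = - s * (poly (w 0) t * (\<Sum>i\<in>I. \<mu> i * x i (Suc j)))"
  proof -
    have "\<forall>k\<le>j. poly ((w(Suc j := 0)) k) t = (\<Sum>i<length vs. \<nu> i * (vs ! i) k)"
      unfolding \<nu> using \<mu>(2) w0 by (simp add: dehom_def)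
    then have "reduce j (zip vs cs) (\<lambda>k. poly ((w(Suc j := 0)) k) t) (Suc j)
       = s * (poly ((w(Suc j := 0)) (Suc j)) t - (\<Sum>i<length vs. \<nu> i * (vs ! i) (Suc j)))"
      by (intro red) (simp add: \<nu>_def)
    then show ?thesis unfolding poly_reduce zip \<nu> by simp
  qed
  let ?w = "next_flat V j w (zip T cs)"
  have w'0: "poly (?w 0) t = s * poly (w 0) t" by (simp add: next_flat_def unit)
  then have nz: "poly (?w 0) t \<noteq> 0" using w0 cs(3) by simp
  have "dehom ?w t (Suc j) = (\<Sum>i\<in>I. \<mu> i * x i (Suc j))"
    unfolding dehom_def w'0 using w0 cs(3) by (simp add: next_flat_def last)
  then have "(\<Sum>i\<in>I. \<mu> i * x i k) = dehom ?w t k" if "k \<le> Suc j" for k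
    using that \<mu>(2) dehom_next_flat[OF nz] by (auto simp: le_Suc_eq)
  then have "in_cone x I (Suc j) (dehom ?w t)"
    unfolding in_cone_def using \<mu>(1) by blast
  then have "in_cone x {..<Suc j} (Suc j) (dehom ?w t)" by (rule in_cone_mono) (use I(1) in auto)
  then show ?thesis using cs nz unfolding x_def by blast
qed

text \<open>In the new fraction, \<open>\<alpha> / 3\<close> is squared because a third of the
  hitting tuples lies on either side of the new coordinate, and \<open>4 ^ Suc j\<close> is the loss
  in \<open>card_hitting_Suc_ge\<close>.\<close>

definition refining_net ::
    "('p \<Rightarrow> nat \<Rightarrow> real poly) \<Rightarrow> 'p set \<Rightarrow> nat \<Rightarrow> nat \<Rightarrow> real \<Rightarrow> (nat \<Rightarrow> real poly) \<Rightarrow>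
      (nat \<Rightarrow> real poly) set \<Rightarrow> bool" where
  "refining_net V P r j \<alpha> w N \<longleftrightarrow>
     (\<forall>t Q. Q \<subseteq> P \<longrightarrow> card P < r * card Q \<longrightarrow> (\<forall>p\<in>Q. poly (V p 0) t \<noteq> 0) \<longrightarrow> poly (w 0) t \<noteq> 0 \<longrightarrow>
        \<alpha> * card Q ^ Suc j \<le> card (hitting (\<lambda>p. dehom (V p) t) Q j (dehom w t)) \<longrightarrow>
        (\<exists>w'\<in>N. poly (w' 0) t \<noteq> 0 \<and>
           \<alpha>\<^sup>2 / (9 * 4 ^ Suc j) * card Q ^ Suc (Suc j)
             \<le> card (hitting (\<lambda>p. dehom (V p) t) Q (Suc j) (dehom w' t))))"

text \<open>The candidates are all tuples over \<open>P\<close> with all pivot sequences, a set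
  independent of time. At time \<open>t\<close> every hitting tuple of \<open>Q\<close> has a pivot
  sequence that works, and the middle third of the resulting values is a heavy range.\<close>

lemma exists_next_level_net:
  fixes j D :: nat and \<alpha> :: real
  assumes \<alpha>: "0 < \<alpha>" "\<alpha> \<le> 1"
  shows "\<exists>K>0. \<forall>r (P :: 'p set) V w. 2 \<le> r \<longrightarrow> finite P \<longrightarrow> P \<noteq> {} \<longrightarrow>
     (\<forall>p\<in>P. \<forall>k\<le>Suc j. degree (V p k) \<le> D) \<longrightarrow> (\<forall>k\<le>j. degree (w k) \<le> D) \<longrightarrow>
     (\<exists>N. finite N \<and> card N \<le> K * (real r ^ Suc j * ln (real r)) \<and>
        (\<forall>w'\<in>N. \<forall>k. degree (w' k) \<le> (2 ^ Suc j + 1) * D) \<and>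
        refining_net V P r j \<alpha> w N)"
proof -
  obtain K0 :: real where K0: "K0 > 0" and net: "\<forall>(X :: ('p \<times> nat) list set) a b (\<epsilon> :: real).
     finite X \<longrightarrow> X \<noteq> {} \<longrightarrow> 0 < \<epsilon> \<longrightarrow> \<epsilon> \<le> 1 / 2 \<longrightarrow>
     (\<forall>i\<in>X. degree (a i) \<le> (2 ^ Suc j + 1) * D \<and> degree (b i) \<le> (2 ^ Suc j + 1) * D) \<longrightarrow>
     (\<exists>N\<subseteq>X. card N \<le> K0 * (1 / \<epsilon>) * ln (1 / \<epsilon>) \<and>
       (\<forall>t u v. \<epsilon> * card X \<le> card {i \<in> X. in_range a b t u v i} \<longrightarrow>
          (\<exists>i\<in>N. in_range a b t u v i)))"
    using kinetic_interval_net[where 'i = "('p \<times> nat) list" and D = "(2 ^ Suc j + 1) * D"]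
    by (elim exE conjE) (rule that)
  \<comment> \<open>The losses are the middle third, the choice of one pivot sequence per tuple and
    the fraction \<alpha>; with \<open>r ^ Suc j\<close> for passing from \<open>P\<close> to
    \<open>Q\<close> they give \<open>1 / \<epsilon>\<close>.\<close>
  define c where "c = 3 * real (j + 2) ^ Suc j / \<alpha>"
  have c: "c \<ge> 3"
  proof -
    have "1 \<le> real (j + 2) ^ Suc j" by (rule one_le_power) simp
    then have "3 * \<alpha> \<le> 3 * real (j + 2) ^ Suc j" using \<alpha> by linarith
    then show ?thesis using \<alpha> by (simp add: c_def pos_le_divide_eq)
  qed
  \<comment> \<open>Since \<open>r \<ge> 2\<close>, the constant \<open>ln c\<close> is at most
    \<open>ln c / ln 2\<close> times \<open>ln r\<close>.\<close>
  define K where "K = K0 * c * (ln c / ln 2 + Suc j)"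
  show ?thesis
  proof (intro exI[of _ K] conjI allI impI)
    show "0 < K" using K0 c by (simp add: K_def add_nonneg_pos)
    fix r :: nat and P :: "'p set" and V :: "'p \<Rightarrow> nat \<Rightarrow> real poly" and w :: "nat \<Rightarrow> real poly"
    assume r: "2 \<le> r" and P: "finite P" "P \<noteq> {}"
      and V: "\<forall>p\<in>P. \<forall>k\<le>Suc j. degree (V p k) \<le> D" and w: "\<forall>k\<le>j. degree (w k) \<le> D"
    define X where "X = tuples (P \<times> {..Suc j}) (Suc j)"
    define \<epsilon> where "\<epsilon> = 1 / (c * real r ^ Suc j)"
    let ?F = "next_flat V j w"
    have X: "finite X" using P by (simp add: X_def finite_tuples)
    have cardX: "real (card X) = real (j + 2) ^ Suc j * real (card P) ^ Suc j"
    proof -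
      have "card X = (card P * (j + 2)) ^ Suc j"
        using P by (simp add: X_def card_tuples card_cartesian_product)
      then show ?thesis by (simp only: of_nat_power of_nat_mult power_mult_distrib mult.commute)
    qed
    have Xne: "X \<noteq> {}" using cardX P by (auto simp: card_gt_0_iff)
    have cr: "3 \<le> c * real r ^ Suc j"
    proof -
      have "1 \<le> real r ^ Suc j" using r by (intro one_le_power) simp
      then have "3 * 1 \<le> c * real r ^ Suc j" using c by (intro mult_mono) auto
      then show ?thesis by simp
    qed
    have \<epsilon>: "0 < \<epsilon>" "\<epsilon> \<le> 1 / 2" using cr by (auto simp: \<epsilon>_def intro!: divide_left_mono)
    have degX: "degree (?F L k) \<le> (2 ^ Suc j + 1) * D" if "L \<in> X" for L k
      by (rule degree_next_flat_le) (use that V w in \<open>auto simp: X_def tuples_def\<close>)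
    let ?in = "in_range (\<lambda>L. ?F L (Suc j)) (\<lambda>L. ?F L 0)"
    have "\<exists>N\<subseteq>X. card N \<le> K0 * (1 / \<epsilon>) * ln (1 / \<epsilon>) \<and>
       (\<forall>t u v. \<epsilon> * card X \<le> card {L \<in> X. ?in t u v L} \<longrightarrow> (\<exists>L\<in>N. ?in t u v L))"
      by (rule net[rule_format, OF X Xne \<epsilon>]) (use degX in simp)
    then obtain N where N: "N \<subseteq> X" "card N \<le> K0 * (1 / \<epsilon>) * ln (1 / \<epsilon>)"
      "\<forall>t u v. \<epsilon> * card X \<le> card {L \<in> X. ?in t u v L} \<longrightarrow> (\<exists>L\<in>N. ?in t u v L)"
      by (elim exE conjE) (rule that)
    have finN: "finite N" using N(1) X by (rule finite_subset)
    have cardN: "card N \<le> K * (real r ^ Suc j * ln r)"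
    proof -
      have lnr: "ln 2 \<le> ln (real r)" using r by simp
      have "ln (1 / \<epsilon>) = ln c + Suc j * ln r"
        using c r by (simp add: \<epsilon>_def ln_mult ln_realpow del: power_Suc)
      also have "\<dots> \<le> ln c / ln 2 * ln r + Suc j * ln r"
      proof -
        have "ln c / ln 2 * ln 2 \<le> ln c / ln 2 * ln r"
          using lnr c by (intro mult_left_mono) auto
        then show ?thesis by simp
      qed
      also have "\<dots> = (ln c / ln 2 + Suc j) * ln r" by (simp add: algebra_simps)
      finally have "K0 * (1 / \<epsilon>) * ln (1 / \<epsilon>) \<le> K0 * (1 / \<epsilon>) * ((ln c / ln 2 + Suc j) * ln r)"
        using K0 \<epsilon> by (intro mult_left_mono) auto
      also have "\<dots> = K * (real r ^ Suc j * ln r)" by (simp add: K_def \<epsilon>_def mult_ac)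
      finally show ?thesis using N(2) by linarith
    qed
    have step: "\<exists>w'\<in>?F ` N. poly (w' 0) t \<noteq> 0 \<and>
          \<alpha>\<^sup>2 / (9 * 4 ^ Suc j) * card Q ^ Suc (Suc j)
             \<le> card (hitting (\<lambda>p. dehom (V p) t) Q (Suc j) (dehom w' t))"
      if Q: "Q \<subseteq> P" "card P < r * card Q" and V0: "\<forall>p\<in>Q. poly (V p 0) t \<noteq> 0" and w0: "poly (w 0) t \<noteq> 0"
        and many: "\<alpha> * card Q ^ Suc j \<le> card (hitting (\<lambda>p. dehom (V p) t) Q j (dehom w t))"
      for t Q
    proof -
      define x where "x = (\<lambda>p. dehom (V p) t)"
      define H where "H = hitting x Q j (dehom w t)"
      have finQ: "finite Q" using Q(1) P(1) by (rule finite_subset)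
      have Qpos: "0 < card Q" using Q(2) by (cases "card Q") auto
      have Htup: "H \<subseteq> tuples Q (Suc j)" by (auto simp: H_def hitting_def)
      have finH: "finite H" using finite_tuples[OF finQ] Htup by (rule rev_finite_subset)
      have cardH: "\<alpha> * card Q ^ Suc j \<le> card H" using many by (simp add: H_def x_def)
      moreover have "0 < \<alpha> * card Q ^ Suc j" using \<alpha>(1) Qpos by simp
      ultimately have Hne: "H \<noteq> {}" by auto
      have "\<exists>cs. length cs = Suc j \<and> set cs \<subseteq> {..Suc j} \<and> poly (?F (zip T cs) 0) t \<noteq> 0 \<and>
          in_cone (\<lambda>i. x (T ! i)) {..<Suc j} (Suc j) (dehom (?F (zip T cs)) t)" if "T \<in> H" for T
        unfolding x_def
        by (rule exists_next_flat) (use that V0 w0 in \<open>auto simp: H_def hitting_def tuples_def x_def\<close>)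
      then obtain cs where cs: "\<And>T. T \<in> H \<Longrightarrow> length (cs T) = Suc j \<and> set (cs T) \<subseteq> {..Suc j} \<and>
          poly (?F (zip T (cs T)) 0) t \<noteq> 0 \<and>
          in_cone (\<lambda>i. x (T ! i)) {..<Suc j} (Suc j) (dehom (?F (zip T (cs T))) t)"
        by metis
      define y where "y = (\<lambda>T. dehom (?F (zip T (cs T))) t (Suc j))"
      have lenH: "length T = Suc j" "set T \<subseteq> Q" if "T \<in> H" for T
        using Htup that by (auto simp: tuples_def)
      obtain u v where uv: "card H \<le> 3 * card {T \<in> H. u \<le> y T \<and> y T \<le> v}"
        "\<And>z. u \<le> z \<Longrightarrow> z \<le> v \<Longrightarrow> card H \<le> 3 * card {T \<in> H. y T \<le> z} \<and> card H \<le> 3 * card {T \<in> H. z \<le> y T}"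
        using exists_middle_third[OF finH Hne, of y] by blast
      let ?R = "{L \<in> X. ?in t u v L}"
      have "card {T \<in> H. u \<le> y T \<and> y T \<le> v} \<le> card ?R"
      proof (rule card_inj_on_le[of "\<lambda>T. zip T (cs T)"])
        show "inj_on (\<lambda>T. zip T (cs T)) {T \<in> H. u \<le> y T \<and> y T \<le> v}"
        proof (rule inj_onI)
          fix T S assume "T \<in> {T \<in> H. u \<le> y T \<and> y T \<le> v}" "S \<in> {T \<in> H. u \<le> y T \<and> y T \<le> v}"
            and eq: "zip T (cs T) = zip S (cs S)"
          then have "T \<in> H" "S \<in> H" by auto
          then have "map fst (zip T (cs T)) = T" "map fst (zip S (cs S)) = S"
            using cs lenH by (simp_all add: map_fst_zip)
          then show "T = S" using eq by metis
        qed
        show "(\<lambda>T. zip T (cs T)) ` {T \<in> H. u \<le> y T \<and> y T \<le> v} \<subseteq> ?R"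
        proof (intro image_subsetI CollectI conjI)
          fix T assume T: "T \<in> {T \<in> H. u \<le> y T \<and> y T \<le> v}"
          then have TH: "T \<in> H" by simp
          have "set (zip T (cs T)) \<subseteq> set T \<times> set (cs T)"
            by (auto dest: set_zip_leftD set_zip_rightD)
          also have "\<dots> \<subseteq> P \<times> {..Suc j}" using cs[OF TH] lenH[OF TH] Q(1) by blast
          finally show "zip T (cs T) \<in> X"
            using cs[OF TH] lenH[OF TH] by (simp add: X_def tuples_def)
          show "?in t u v (zip T (cs T))"
            using T cs[OF TH] by (simp add: in_range_def y_def dehom_def)
        qed
      qed (use X in simp)
      with uv(1) have "card H \<le> 3 * card ?R" by linarith
      then have HR: "real (card H) / 3 \<le> card ?R" by linarith
      have "\<epsilon> * card X \<le> card ?R"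
      proof -
        have "\<epsilon> * card X = \<alpha> / 3 * (real (card P) / r) ^ Suc j"
        proof -
          have "1 / (3 * A / \<alpha> * R) * (A * M) = \<alpha> / 3 * (M / R)" if "A \<noteq> 0" for A M R :: real
            using that \<alpha> by simp
          then show ?thesis unfolding cardX \<epsilon>_def c_def power_divide by simp
        qed
        also have "\<dots> \<le> \<alpha> / 3 * real (card Q) ^ Suc j"
        proof (intro mult_left_mono power_mono)
          have "real (card P) \<le> real (r * card Q)" using Q(2) by (simp only: of_nat_le_iff)
          then show "real (card P) / r \<le> card Q" using r by (simp add: divide_le_eq mult.commute)
        qed (use \<alpha> in auto)
        also have "\<dots> \<le> card ?R" using cardH HR by (simp del: power_Suc)
        finally show ?thesis .
      qed
      \<comment> \<open>\<open>L\<close> may come from points outside \<open>Q\<close>; only its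
        value at time \<open>t\<close> counts.\<close>
      then obtain L where L: "L \<in> N" "?in t u v L"
        using N(3)[rule_format, of t u v] by blast
      define a where "a = dehom (?F L) t"
      have nz: "poly (?F L 0) t \<noteq> 0" and z: "u \<le> a (Suc j)" "a (Suc j) \<le> v"
        using L(2) by (auto simp: in_range_def a_def dehom_def)
      \<comment> \<open>After division by coordinate 0 all candidates defined at \<open>t\<close>
        agree with \<open>w\<close> up to coordinate \<open>j\<close>, so those of different tuples
        differ in the last coordinate only.\<close>
      have cone: "in_cone (\<lambda>i. x (T ! i)) {..<Suc j} (Suc j) (a(Suc j := y T))" if T: "T \<in> H" for T
      proof -
        have "dehom (?F (zip T (cs T))) t k = (a(Suc j := y T)) k" if "k \<le> Suc j" for k
          using that cs[OF T] nz by (auto simp: le_Suc_eq y_def a_def dehom_next_flat)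
        then show ?thesis using cs[OF T] by (blast intro: in_cone_cong[THEN iffD1, rotated 2])
      qed
      let ?A = "{T \<in> H. y T \<le> a (Suc j)}" and ?A' = "{T \<in> H. a (Suc j) \<le> y T}"
      have prod: "card ?A * card ?A' \<le> 4 ^ Suc j * card Q ^ j * card (hitting x Q (Suc j) a)"
        by (rule card_hitting_Suc_ge[OF finQ]) (use Htup cone in auto)
      have "card H \<le> 3 * card ?A" "card H \<le> 3 * card ?A'" using uv(2)[OF z] by auto
      then have third: "\<alpha> * card Q ^ Suc j / 3 \<le> card ?A" "\<alpha> * card Q ^ Suc j / 3 \<le> card ?A'"
        using cardH by linarith+
      have "\<alpha>\<^sup>2 / 9 * card Q ^ Suc (Suc j) * real (card Q) ^ j = (\<alpha> * card Q ^ Suc j / 3) * (\<alpha> * card Q ^ Suc j / 3)"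
      proof -
        have "q ^ Suc (Suc j) * q ^ j = q ^ Suc j * q ^ Suc j" for q :: real by simp
        then show ?thesis by (simp add: power2_eq_square del: power_Suc)
      qed
      also have "\<dots> \<le> real (card ?A) * card ?A'"
        using third \<alpha> by (intro mult_mono) auto
      also have "\<dots> \<le> 4 ^ Suc j * card (hitting x Q (Suc j) a) * real (card Q) ^ j"
      proof -
        have "real (card ?A * card ?A') \<le> real (4 ^ Suc j * card Q ^ j * card (hitting x Q (Suc j) a))"
          using prod by (simp only: of_nat_le_iff)
        then show ?thesis by (simp add: mult_ac)
      qed
      finally have "\<alpha>\<^sup>2 / 9 * card Q ^ Suc (Suc j) \<le> 4 ^ Suc j * card (hitting x Q (Suc j) a)"
        using Qpos by (simp del: power_Suc)
      then have "\<alpha>\<^sup>2 / (9 * 4 ^ Suc j) * card Q ^ Suc (Suc j) \<le> card (hitting x Q (Suc j) a)"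
        by (simp add: field_simps del: power_Suc)
      then show ?thesis using L(1) nz unfolding a_def x_def by blast
    qed
    show "\<exists>N. finite N \<and> card N \<le> K * (real r ^ Suc j * ln (real r)) \<and>
        (\<forall>w'\<in>N. \<forall>k. degree (w' k) \<le> (2 ^ Suc j + 1) * D) \<and>
        refining_net V P r j \<alpha> w N"
    proof (intro exI[of _ "?F ` N"] conjI)
      show "finite (?F ` N)" using finN by simp
      have "real (card (?F ` N)) \<le> card N" using card_image_le[OF finN] by simp
      then show "card (?F ` N) \<le> K * (real r ^ Suc j * ln (real r))" using cardN by linarith
      show "\<forall>w'\<in>?F ` N. \<forall>k. degree (w' k) \<le> (2 ^ Suc j + 1) * D" using degX N(1) by blast
    qed (use step in \<open>simp add: refining_net_def\<close>)
  qed
qed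

definition flat_net ::
    "('p \<Rightarrow> nat \<Rightarrow> real poly) \<Rightarrow> 'p set \<Rightarrow> nat \<Rightarrow> nat \<Rightarrow> real \<Rightarrow> (nat \<Rightarrow> real poly) set \<Rightarrow> bool" where
  "flat_net V P r j \<alpha> N \<longleftrightarrow>
     (\<forall>t Q. Q \<subseteq> P \<longrightarrow> card P < r * card Q \<longrightarrow> (\<forall>p\<in>Q. poly (V p 0) t \<noteq> 0) \<longrightarrow>
        (\<exists>w\<in>N. poly (w 0) t \<noteq> 0 \<and>
           \<alpha> * card Q ^ Suc j \<le> card (hitting (\<lambda>p. dehom (V p) t) Q j (dehom w t))))"

text \<open>\<open>K\<close>, \<open>D'\<close> and \<alpha> are chosen before \<open>r\<close> and
  \<open>P\<close>, so the degree bound is free of \<open>r\<close>. In the step every flat of the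
  previous net gets its own refining net, hence sizes multiply and the exponent of \<open>r\<close>
  grows by \<open>j + 1\<close>.\<close>

lemma exists_flat_net:
  fixes D j :: nat
  shows "\<exists>K D' (\<alpha> :: real). 0 < K \<and> 0 < \<alpha> \<and> \<alpha> \<le> 1 \<and> (\<forall>r (P :: 'p set) V. 2 \<le> r \<longrightarrow> finite P \<longrightarrow> P \<noteq> {} \<longrightarrow>
     (\<forall>p\<in>P. \<forall>k\<le>j. degree (V p k) \<le> D) \<longrightarrow>
     (\<exists>N. finite N \<and> card N \<le> K * (real r ^ (j * (j + 1) div 2) * ln (real r) ^ j) \<and>
        (\<forall>w\<in>N. \<forall>k\<le>j. degree (w k) \<le> D') \<and>
        flat_net V P r j \<alpha> N))"
proof (induction j)
  case 0
  show ?case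
  \<comment> \<open>With no coordinate fixed, the constant 1 stands for the whole space, and every
    tuple of length 1 hits it.\<close>
  proof (rule exI[of _ "1 :: real"], rule exI[of _ 0], rule exI[of _ "1 :: real"], intro conjI allI impI)
    fix r :: nat and P :: "'p set" and V :: "'p \<Rightarrow> nat \<Rightarrow> real poly"
    assume P: "finite P"
    let ?N = "{(\<lambda>_. 1) :: nat \<Rightarrow> real poly}"
    have "hitting (\<lambda>p. dehom (V p) t) Q 0 (dehom (\<lambda>_. 1) t) = tuples Q 1"
      if "\<forall>p\<in>Q. poly (V p 0) t \<noteq> 0" for t Q
    proof -
      have "T ! 0 \<in> Q" if "T \<in> tuples Q 1" for T
        using that nth_mem[of 0 T] by (auto simp: tuples_def)
      then show ?thesis
        using that by (auto simp: hitting_def in_cone_def dehom_def intro!: exI[of _ "\<lambda>_. 1"])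
    qed
    then have "flat_net V P r 0 1 ?N"
      using P by (auto simp: flat_net_def card_tuples finite_subset)
    then show "\<exists>N. finite N \<and> card N \<le> 1 * (real r ^ (0 * (0 + 1) div 2) * ln (real r) ^ 0) \<and>
        (\<forall>w\<in>N. \<forall>k\<le>0. degree (w k) \<le> 0) \<and>
        flat_net V P r 0 1 N"
      by (intro exI[of _ ?N] conjI) auto
  qed auto
next
  case (Suc j)
  from Suc.IH obtain K1 D1 and \<alpha> :: real where K1: "0 < K1" and \<alpha>: "0 < \<alpha>" "\<alpha> \<le> 1"
    and IH: "\<forall>r (P :: 'p set) V. 2 \<le> r \<longrightarrow> finite P \<longrightarrow> P \<noteq> {} \<longrightarrow>
     (\<forall>p\<in>P. \<forall>k\<le>j. degree (V p k) \<le> D) \<longrightarrow>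
     (\<exists>N. finite N \<and> card N \<le> K1 * (real r ^ (j * (j + 1) div 2) * ln (real r) ^ j) \<and>
        (\<forall>w\<in>N. \<forall>k\<le>j. degree (w k) \<le> D1) \<and> flat_net V P r j \<alpha> N)"
    by (elim exE conjE) (rule that)
  \<comment> \<open>The next step has a single degree bound for the given points and the flats
    already constructed.\<close>
  define D2 where "D2 = max D D1"
  define \<alpha>' where "\<alpha>' = \<alpha>\<^sup>2 / (9 * 4 ^ Suc j)"
  obtain K2 where K2: "0 < K2" and nxt: "\<And>r (P :: 'p set) V w. \<lbrakk>2 \<le> r; finite P; P \<noteq> {};
     \<forall>p\<in>P. \<forall>k\<le>Suc j. degree (V p k) \<le> D2; \<forall>k\<le>j. degree (w k) \<le> D2\<rbrakk> \<Longrightarrow>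
     \<exists>N. finite N \<and> card N \<le> K2 * (real r ^ Suc j * ln (real r)) \<and>
        (\<forall>w'\<in>N. \<forall>k. degree (w' k) \<le> (2 ^ Suc j + 1) * D2) \<and> refining_net V P r j \<alpha> w N"
    using exists_next_level_net[where 'p = 'p and j = j and D = D2, OF \<alpha>] by (elim exE conjE) blast
  have \<alpha>': "0 < \<alpha>'" "\<alpha>' \<le> 1"
  proof -
    show "0 < \<alpha>'" using \<alpha> by (simp add: \<alpha>'_def)
    have "\<alpha>\<^sup>2 \<le> 1" using \<alpha> by (simp add: power_le_one)
    moreover have "(1::real) \<le> 4 ^ Suc j" by (rule one_le_power) simp
    ultimately have "\<alpha>\<^sup>2 \<le> 9 * 4 ^ Suc j" by linarith
    then show "\<alpha>' \<le> 1" by (simp add: \<alpha>'_def divide_le_eq del: power_Suc)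
  qed
  show ?case
  proof (rule exI[of _ "K1 * K2"], rule exI[of _ "(2 ^ Suc j + 1) * D2"], rule exI[of _ \<alpha>'],
      intro conjI allI impI \<alpha>')
    show "0 < K1 * K2" using K1 K2 by simp
    fix r :: nat and P :: "'p set" and V :: "'p \<Rightarrow> nat \<Rightarrow> real poly"
    assume r: "2 \<le> r" and P: "finite P" "P \<noteq> {}" and V: "\<forall>p\<in>P. \<forall>k\<le>Suc j. degree (V p k) \<le> D"
    obtain N1 where N1: "finite N1" "card N1 \<le> K1 * (real r ^ (j * (j + 1) div 2) * ln (real r) ^ j)"
      and deg1: "\<forall>w\<in>N1. \<forall>k\<le>j. degree (w k) \<le> D1"
      and hit1: "flat_net V P r j \<alpha> N1"
      using IH[rule_format, OF r P, of V] V by (metis le_SucI)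
    have V2: "\<forall>p\<in>P. \<forall>k\<le>Suc j. degree (V p k) \<le> D2" using V by (auto simp: D2_def le_max_iff_disj)
    have "\<forall>w\<in>N1. \<exists>N. finite N \<and> card N \<le> K2 * (real r ^ Suc j * ln (real r)) \<and>
        (\<forall>w'\<in>N. \<forall>k. degree (w' k) \<le> (2 ^ Suc j + 1) * D2) \<and> refining_net V P r j \<alpha> w N"
      (is "\<forall>w\<in>N1. ?ex w")
    proof
      fix w assume "w \<in> N1"
      then have "\<forall>k\<le>j. degree (w k) \<le> D2" using deg1 by (auto simp: D2_def le_max_iff_disj)
      then show "?ex w" by (rule nxt[OF r P V2])
    qed
    from bchoice[OF this] obtain M where M: "\<forall>w\<in>N1. finite (M w) \<and>
        card (M w) \<le> K2 * (real r ^ Suc j * ln (real r)) \<and>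
        (\<forall>w'\<in>M w. \<forall>k. degree (w' k) \<le> (2 ^ Suc j + 1) * D2) \<and> refining_net V P r j \<alpha> w (M w)" ..
    define N where "N = (\<Union>w\<in>N1. M w)"
    have finN: "finite N" using N1(1) M unfolding N_def by simp
    have lnr: "0 \<le> ln (real r)" using r by simp
    have cardN: "card N \<le> K1 * K2 * (real r ^ (Suc j * (Suc j + 1) div 2) * ln (real r) ^ Suc j)"
    proof -
      have "card N \<le> (\<Sum>w\<in>N1. card (M w))" unfolding N_def using N1(1) by (rule card_UN_le)
      then have "real (card N) \<le> (\<Sum>w\<in>N1. real (card (M w)))" by (metis of_nat_le_iff of_nat_sum)
      also have "\<dots> \<le> (\<Sum>w\<in>N1. K2 * (real r ^ Suc j * ln (real r)))"
        by (rule sum_mono) (use M in blast)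
      also have "\<dots> = card N1 * (K2 * (real r ^ Suc j * ln (real r)))" by simp
      also have "\<dots> \<le> K1 * (real r ^ (j * (j + 1) div 2) * ln (real r) ^ j) * (K2 * (real r ^ Suc j * ln (real r)))"
        using N1(2) K2 lnr by (intro mult_right_mono) auto
      also have "\<dots> = K1 * K2 * (real r ^ (j * (j + 1) div 2 + Suc j) * ln (real r) ^ Suc j)"
        by (simp add: power_add mult_ac)
      also have "j * (j + 1) div 2 + Suc j = Suc j * (Suc j + 1) div 2"
      proof -
        have "Suc j * (Suc j + 1) = j * (j + 1) + Suc j * 2" by simp
        moreover have "(a + Suc j * 2) div 2 = a div 2 + Suc j" for a :: nat by simp
        ultimately show ?thesis by simp
      qed
      finally show ?thesis .
    qed
    have degN: "\<forall>w\<in>N. \<forall>k\<le>Suc j. degree (w k) \<le> (2 ^ Suc j + 1) * D2"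
      using M unfolding N_def by blast
    have hitN: "\<exists>w\<in>N. poly (w 0) t \<noteq> 0 \<and>
        \<alpha>' * card Q ^ Suc (Suc j) \<le> card (hitting (\<lambda>p. dehom (V p) t) Q (Suc j) (dehom w t))"
      if Q: "Q \<subseteq> P" "card P < r * card Q" "\<forall>p\<in>Q. poly (V p 0) t \<noteq> 0" for t Q
    proof -
      obtain w where w: "w \<in> N1" "poly (w 0) t \<noteq> 0"
        "\<alpha> * card Q ^ Suc j \<le> card (hitting (\<lambda>p. dehom (V p) t) Q j (dehom w t))"
        using hit1 Q unfolding flat_net_def by blast
      have ref: "refining_net V P r j \<alpha> w (M w)" using M w(1) by blast
      have "\<exists>w'\<in>M w. poly (w' 0) t \<noteq> 0 \<and>
          \<alpha>' * card Q ^ Suc (Suc j) \<le> card (hitting (\<lambda>p. dehom (V p) t) Q (Suc j) (dehom w' t))"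
        unfolding \<alpha>'_def
        by (rule ref[unfolded refining_net_def, rule_format, OF Q(1,2) _ w(2,3)]) (use Q(3) in blast)
      then show ?thesis using w(1) unfolding N_def by blast
    qed
    show "\<exists>N. finite N \<and> card N \<le> K1 * K2 * (real r ^ (Suc j * (Suc j + 1) div 2) * ln (real r) ^ Suc j) \<and>
        (\<forall>w\<in>N. \<forall>k\<le>Suc j. degree (w k) \<le> (2 ^ Suc j + 1) * D2) \<and>
        flat_net V P r (Suc j) \<alpha>' N"
      by (intro exI[of _ N] conjI finN cardN degN) (use hitN in \<open>simp add: flat_net_def\<close>)
  qed
qed

section \<open>Moving points\<close>

text \<open>The product of all denominators serves as common denominator, and each numerator is
  multiplied by the denominators of the other coordinates. No factor vanishes at a time where
  \<open>p\<close> is defined.\<close>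

lemma exists_homogeneous_coordinates:
  fixes p :: "('d::finite) moving_point"
  assumes f: "has_coordinates p f" "\<And>i. rational_function \<beta> (f i)" and e: "e ` {1..CARD('d)} = UNIV"
  shows "\<exists>v :: nat \<Rightarrow> real poly. (\<forall>k\<le>CARD('d). degree (v k) \<le> CARD('d) * \<beta>) \<and>
     (\<forall>t\<ge>0. \<forall>x. p t = Some x \<longrightarrow> poly (v 0) t \<noteq> 0 \<and> (\<forall>k\<in>{1..CARD('d)}. dehom v t k = x $ e k))"
proof -
  have "\<forall>i. \<exists>a b :: real poly. degree a \<le> \<beta> \<and> degree b \<le> \<beta> \<and>
        f i = (\<lambda>t. if poly b t = 0 then None else Some (poly a t / poly b t))"
    using f(2) unfolding rational_function_def by blast
  then obtain a b :: "'d \<Rightarrow> real poly" where ab: "\<And>i. degree (a i) \<le> \<beta>" "\<And>i. degree (b i) \<le> \<beta>"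
    "\<And>i. f i = (\<lambda>t. if poly (b i) t = 0 then None else Some (poly (a i) t / poly (b i) t))"
    by metis
  define v where "v = (\<lambda>k. if k = 0 then \<Prod>i\<in>UNIV. b i else a (e k) * (\<Prod>i\<in>UNIV - {e k}. b i))"
  have degb: "degree (\<Prod>i\<in>S. b i) \<le> card S * \<beta>" for S :: "'d set"
  proof -
    have "degree (\<Prod>i\<in>S. b i) \<le> (\<Sum>i\<in>S. degree (b i))"
      using degree_prod_sum_le[of S b] by simp
    also have "\<dots> \<le> card S * \<beta>" using sum_bounded_above[of S "\<lambda>i. degree (b i)" \<beta>] ab(2) by simp
    finally show ?thesis .
  qed
  have "degree (v k) \<le> CARD('d) * \<beta>" for k
  proof (cases "k = 0")
    case True
    then show ?thesis using degb[of UNIV] by (simp add: v_def)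
  next
    case False
    have "degree (v k) \<le> \<beta> + card (UNIV - {e k}) * \<beta>"
      using False degree_mult_le[of "a (e k)" "\<Prod>i\<in>UNIV - {e k}. b i"] ab(1)[of "e k"] degb[of "UNIV - {e k}"]
      by (simp add: v_def)
    also have "\<dots> = Suc (card (UNIV - {e k})) * \<beta>" by (simp only: mult_Suc)
    also have "Suc (card (UNIV - {e k})) = CARD('d)" by (simp only: card_Suc_Diff1 finite UNIV_I)
    finally show ?thesis .
  qed
  moreover have "poly (v 0) t \<noteq> 0 \<and> (\<forall>k\<in>{1..CARD('d)}. dehom v t k = x $ e k)"
    if t: "t \<ge> 0" "p t = Some x" for t x
  proof -
    have "Some x = (if \<exists>i. f i t = None then None else Some (\<chi> i. the (f i t)))"
      using f(1) t unfolding has_coordinates_def by metis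
    then have nz: "\<And>i. poly (b i) t \<noteq> 0" and x: "x = (\<chi> i. poly (a i) t / poly (b i) t)"
      by (auto simp: ab(3) split: if_splits)
    have v0: "poly (v 0) t \<noteq> 0" using nz by (simp add: v_def poly_prod)
    have "dehom v t k = x $ e k" if "k \<in> {1..CARD('d)}" for k
    proof -
      have "poly (\<Prod>i\<in>UNIV. b i) t = poly (b (e k)) t * poly (\<Prod>i\<in>UNIV - {e k}. b i) t"
        by (simp add: prod.remove[of UNIV "e k"])
      moreover have "poly (\<Prod>i\<in>UNIV - {e k}. b i) t \<noteq> 0" using nz by (simp add: poly_prod)
      ultimately show ?thesis using that nz by (simp add: dehom_def v_def x)
    qed
    then show ?thesis using v0 by blast
  qed
  ultimately show ?thesis by blast
qed

definition moving_point_of :: "('d::finite \<Rightarrow> nat) \<Rightarrow> (nat \<Rightarrow> real poly) \<Rightarrow> 'd moving_point" where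
  "moving_point_of idx w t = (if t < 0 \<or> poly (w 0) t = 0 then None else Some (\<chi> i. dehom w t (idx i)))"

lemma description_complexity_moving_point_of:
  fixes idx :: "'d::finite \<Rightarrow> nat"
  assumes "\<And>w k. w \<in> N \<Longrightarrow> k \<le> CARD('d) \<Longrightarrow> degree (w k) \<le> D" "\<And>w. w \<in> N \<Longrightarrow> w 0 \<noteq> 0"
    and "\<And>i. idx i \<le> CARD('d)"
  shows "description_complexity D (moving_point_of idx ` N)"
  unfolding description_complexity_def
proof (intro ballI conjI)
  fix p assume "p \<in> moving_point_of idx ` N"
  then obtain w where w: "w \<in> N" "p = moving_point_of idx w" by blast
  show "is_moving_point p"
    by (auto simp: is_moving_point_def w(2) moving_point_of_def dom_def split: if_splits)
  define f where "f = (\<lambda>i t. if poly (w 0) t = 0 then None else Some (poly (w (idx i)) t / poly (w 0) t))"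
  have "has_coordinates p f"
    by (auto simp: has_coordinates_def w(2) moving_point_of_def f_def dehom_def)
  moreover have "rational_function D (f i)" for i
    unfolding rational_function_def f_def
    by (rule exI[of _ "w (idx i)"], rule exI[of _ "w 0"]) (use assms w(1) in auto)
  ultimately show "\<exists>f. has_coordinates p f \<and> (\<forall>i. rational_function D (f i))" by blast
qed

lemma finite_points_at: "finite P \<Longrightarrow> finite (points_at P t)"
  and card_points_at_le: "finite P \<Longrightarrow> card (points_at P t) \<le> card P"
proof -
  assume P: "finite P"
  have sub: "points_at P t \<subseteq> (\<lambda>p. the (p t)) ` P" by (force simp: points_at_def)
  then show "finite (points_at P t)" using P by (simp add: finite_subset)
  have "card (points_at P t) \<le> card ((\<lambda>p. the (p t)) ` P)" using P sub by (intro card_mono) auto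
  also have "\<dots> \<le> card P" using P by (rule card_image_le)
  finally show "card (points_at P t) \<le> card P" .
qed

text \<open>With all coordinates fixed the flat is a point, and a single hitting tuple of
  \<open>Q\<close> exhibits it as a convex combination of points of \<open>C\<close>.\<close>

lemma kinetic_weak_net_of_flat_net:
  fixes P :: "('d::finite) moving_point set"
  assumes P: "finite P" and r: "0 < r" and \<alpha>: "0 < \<alpha>" and e: "bij_betw e {1..CARD('d)} (UNIV :: 'd set)"
    and V: "\<And>p t x. p \<in> P \<Longrightarrow> t \<ge> 0 \<Longrightarrow> p t = Some x \<Longrightarrow>
      poly (V p 0) t \<noteq> 0 \<and> (\<forall>k\<in>{1..CARD('d)}. dehom (V p) t k = x $ e k)"
    and net: "flat_net V P r CARD('d) \<alpha> N"
  shows "kinetic_weak_net r P (moving_point_of (inv_into {1..CARD('d)} e) ` {w \<in> N. w 0 \<noteq> 0})"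
  unfolding kinetic_weak_net_def
proof (intro conjI ballI allI impI)
  define idx where "idx = inv_into {1..CARD('d)} e"
  have idx: "idx i \<in> {1..CARD('d)}" "e (idx i) = i" for i
  proof -
    have "i \<in> e ` {1..CARD('d)}" using e by (simp add: bij_betw_def)
    then show "idx i \<in> {1..CARD('d)}" "e (idx i) = i" unfolding idx_def
      by (rule inv_into_into, rule f_inv_into_f)
  qed
  fix t :: real and C :: "(real ^ 'd) set"
  assume t: "0 \<le> t" and C: "convex C \<and> real (card P) / real r < real (card (C \<inter> points_at P t))"
  define S where "S = C \<inter> points_at P t"
  have finS: "finite S" using finite_points_at[OF P] by (simp add: S_def)
  \<comment> \<open>The heaviness of \<open>C\<close> counts positions, that of \<open>Q\<close>
    counts moving points. Since moving points may coincide at time \<open>t\<close>, one is picked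
    for each position.\<close>
  have "\<forall>x\<in>S. \<exists>p. p \<in> P \<and> p t = Some x" by (auto simp: S_def points_at_def)
  from bchoice[OF this] obtain q where q: "\<And>x. x \<in> S \<Longrightarrow> q x \<in> P" "\<And>x. x \<in> S \<Longrightarrow> q x t = Some x" by blast
  define Q where "Q = q ` S"
  have "inj_on q S" by (rule inj_onI) (metis q(2) option.inject)
  then have cardQ: "card Q = card S" by (simp add: Q_def card_image)
  have QP: "Q \<subseteq> P" using q(1) by (auto simp: Q_def)
  have "real (card P) < real (r * card Q)"
    using C r by (simp add: cardQ S_def divide_less_eq mult.commute)
  then have big: "card P < r * card Q" by (simp only: of_nat_less_iff)
  have val: "\<exists>x\<in>C. poly (V p 0) t \<noteq> 0 \<and> (\<forall>i. dehom (V p) t (idx i) = x $ i)" if p: "p \<in> Q" for p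
  proof -
    obtain x where "x \<in> S" "p = q x" using p by (auto simp: Q_def)
    then show ?thesis using V[of p t x] q t idx by (intro bexI[of _ x]) (auto simp: S_def)
  qed
  then obtain w where w: "w \<in> N" "poly (w 0) t \<noteq> 0"
    "\<alpha> * card Q ^ Suc CARD('d) \<le> card (hitting (\<lambda>p. dehom (V p) t) Q CARD('d) (dehom w t))"
    using net QP big unfolding flat_net_def by blast
  have "0 < card Q" using big by (cases "card Q") auto
  then have "0 < \<alpha> * card Q ^ Suc CARD('d)" using \<alpha> by simp
  then have "hitting (\<lambda>p. dehom (V p) t) Q CARD('d) (dehom w t) \<noteq> {}" using w(3) by auto
  then obtain T where T: "T \<in> tuples Q (Suc CARD('d))"
    "in_cone (\<lambda>i. dehom (V (T ! i)) t) {..<Suc CARD('d)} CARD('d) (dehom w t)"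
    by (auto simp: hitting_def)
  then obtain \<mu> where \<mu>: "\<forall>i\<in>{..<Suc CARD('d)}. 0 \<le> \<mu> i"
    "\<And>k. k \<le> CARD('d) \<Longrightarrow> (\<Sum>i<Suc CARD('d). \<mu> i * dehom (V (T ! i)) t k) = dehom w t k"
    unfolding in_cone_def by blast
  have TQ: "T ! i \<in> Q" if "i < Suc CARD('d)" for i
    using T(1) that nth_mem[of i T] by (auto simp: tuples_def)
  then have "\<forall>i\<in>{..<Suc CARD('d)}. \<exists>x. x \<in> C \<and> poly (V (T ! i) 0) t \<noteq> 0 \<and>
      (\<forall>l. dehom (V (T ! i)) t (idx l) = x $ l)" using val by blast
  from bchoice[OF this] obtain x where x: "\<And>i. i < Suc CARD('d) \<Longrightarrow> x i \<in> C"
    "\<And>i. i < Suc CARD('d) \<Longrightarrow> poly (V (T ! i) 0) t \<noteq> 0"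
    "\<And>i l. i < Suc CARD('d) \<Longrightarrow> dehom (V (T ! i)) t (idx l) = x i $ l" by blast
  define z where "z = (\<chi> i. dehom w t (idx i))"
  \<comment> \<open>Coordinate 0 of every normalised vector is 1, so the cone equation for
    \<open>k = 0\<close> gives the sum of the weights.\<close>
  have "(\<Sum>i<Suc CARD('d). \<mu> i) = (\<Sum>i<Suc CARD('d). \<mu> i * dehom (V (T ! i)) t 0)"
    by (intro sum.cong) (auto simp: dehom_def x(2))
  also have "\<dots> = 1" using \<mu>(2)[of 0] w(2) by (simp add: dehom_def)
  finally have one: "(\<Sum>i<Suc CARD('d). \<mu> i) = 1" .
  have "(\<Sum>i<Suc CARD('d). \<mu> i *\<^sub>R x i) = z"
  proof (rule vec_eq_iff[THEN iffD2], rule allI)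
    fix l
    have "(\<Sum>i<Suc CARD('d). \<mu> i *\<^sub>R x i) $ l = (\<Sum>i<Suc CARD('d). \<mu> i * dehom (V (T ! i)) t (idx l))"
      unfolding sum_component by (intro sum.cong) (auto simp: x(3))
    also have "\<dots> = z $ l" using \<mu>(2)[of "idx l"] idx(1)[of l] by (simp add: z_def)
    finally show "(\<Sum>i<Suc CARD('d). \<mu> i *\<^sub>R x i) $ l = z $ l" .
  qed
  moreover have "(\<Sum>i<Suc CARD('d). \<mu> i *\<^sub>R x i) \<in> C"
    by (rule convex_sum) (use C one \<mu>(1) x(1) in auto)
  ultimately have "z \<in> C" by simp
  moreover have "moving_point_of idx w t = Some z" using t w(2) by (simp add: moving_point_of_def z_def)
  moreover have "w 0 \<noteq> 0" using w(2) by auto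
  ultimately show "C \<inter> points_at (moving_point_of (inv_into {1..CARD('d)} e) ` {w \<in> N. w 0 \<noteq> 0}) t \<noteq> {}"
    using w(1) unfolding points_at_def idx_def by blast
qed (auto simp: is_moving_point_def moving_point_of_def dom_def split: if_splits)

theorem mainTheorem2:
  "\<exists>(c :: nat \<Rightarrow> nat \<Rightarrow> nat) (g :: nat \<Rightarrow> nat).
     (\<forall>r \<beta>. r \<ge> 1 \<and> \<beta> \<ge> 1 \<longrightarrow>
        (\<forall>P :: ('d::finite) moving_point set.
           finite P \<and> description_complexity \<beta> P \<and> general_position P \<longrightarrow>
             (\<exists>N. kinetic_weak_net r P N \<and> finite N \<and> card N \<le> c r \<beta> \<and>
                  description_complexity (g \<beta>) N))) \<and>
     (\<forall>\<beta>\<ge>1. \<exists>K :: real. \<forall>r\<ge>2.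
        real (c r \<beta>) \<le>
          K * (real r ^ (CARD('d) * (CARD('d) + 1) div 2) * ln (real r) ^ CARD('d)))"
proof -
  let ?d = "CARD('d)"
  let ?b = "\<lambda>r. real r ^ (?d * (?d + 1) div 2) * ln (real r) ^ ?d"
  obtain e where e: "bij_betw e {1..?d} (UNIV :: 'd set)"
    using ex_bij_betw_nat_finite_1[of "UNIV :: 'd set"] by auto
  have "\<forall>\<beta>. \<exists>K D' (\<alpha> :: real). 0 < K \<and> 0 < \<alpha> \<and> \<alpha> \<le> 1 \<and>
     (\<forall>r (P :: 'd moving_point set) V. 2 \<le> r \<longrightarrow> finite P \<longrightarrow> P \<noteq> {} \<longrightarrow>
     (\<forall>p\<in>P. \<forall>k\<le>?d. degree (V p k) \<le> ?d * \<beta>) \<longrightarrow>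
     (\<exists>N. finite N \<and> card N \<le> K * ?b r \<and>
        (\<forall>w\<in>N. \<forall>k\<le>?d. degree (w k) \<le> D') \<and> flat_net V P r ?d \<alpha> N))"
    by (intro allI exists_flat_net)
  from choice[OF this] obtain K where "\<forall>\<beta>. \<exists>D' (\<alpha> :: real). 0 < K \<beta> \<and> 0 < \<alpha> \<and> \<alpha> \<le> 1 \<and>
     (\<forall>r (P :: 'd moving_point set) V. 2 \<le> r \<longrightarrow> finite P \<longrightarrow> P \<noteq> {} \<longrightarrow>
     (\<forall>p\<in>P. \<forall>k\<le>?d. degree (V p k) \<le> ?d * \<beta>) \<longrightarrow>
     (\<exists>N. finite N \<and> card N \<le> K \<beta> * ?b r \<and>
        (\<forall>w\<in>N. \<forall>k\<le>?d. degree (w k) \<le> D') \<and> flat_net V P r ?d \<alpha> N))" ..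
  from choice[OF this] obtain D where D: "\<forall>\<beta>. \<exists>\<alpha> :: real. 0 < K \<beta> \<and> 0 < \<alpha> \<and> \<alpha> \<le> 1 \<and>
     (\<forall>r (P :: 'd moving_point set) V. 2 \<le> r \<longrightarrow> finite P \<longrightarrow> P \<noteq> {} \<longrightarrow>
     (\<forall>p\<in>P. \<forall>k\<le>?d. degree (V p k) \<le> ?d * \<beta>) \<longrightarrow>
     (\<exists>N. finite N \<and> card N \<le> K \<beta> * ?b r \<and>
        (\<forall>w\<in>N. \<forall>k\<le>?d. degree (w k) \<le> D \<beta>) \<and> flat_net V P r ?d \<alpha> N))" ..
  define c where "c = (\<lambda>r \<beta>. nat \<lfloor>K \<beta> * ?b r\<rfloor>)"
  have exN: "\<exists>N. kinetic_weak_net r P N \<and> finite N \<and> card N \<le> c r \<beta> \<and> description_complexity (D \<beta>) N"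
    if r: "r \<ge> 1" and P: "finite P" "description_complexity \<beta> P" for r \<beta> and P :: "'d moving_point set"
  proof (cases "P = {} \<or> r = 1")
    case True
    \<comment> \<open>For \<open>r = 1\<close> the bound is 0 because \<open>ln 1 = 0\<close>. In
      both cases no convex set holds more than \<open>card P / r\<close> positions, so the empty net
      works.\<close>
    have "kinetic_weak_net r P {}"
      unfolding kinetic_weak_net_def
    proof (intro conjI ballI allI impI)
      fix t :: real and C :: "(real ^ 'd) set"
      assume "convex C \<and> real (card P) / real r < real (card (C \<inter> points_at P t))"
      moreover have "card (C \<inter> points_at P t) \<le> card P"
        using card_mono[OF finite_points_at[OF P(1)], of "C \<inter> points_at P t" t] card_points_at_le[OF P(1), of t]
        by simp
      ultimately show "C \<inter> points_at {} t \<noteq> {}" using True by auto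
    qed simp
    then show ?thesis by (intro exI[of _ "{}"]) (simp add: description_complexity_def)
  next
    case False
    then have r2: "2 \<le> r" and P2: "P \<noteq> {}" using r by auto
    have "\<forall>p\<in>P. \<exists>v :: nat \<Rightarrow> real poly. (\<forall>k\<le>?d. degree (v k) \<le> ?d * \<beta>) \<and>
       (\<forall>t\<ge>0. \<forall>x. p t = Some x \<longrightarrow> poly (v 0) t \<noteq> 0 \<and> (\<forall>k\<in>{1..?d}. dehom v t k = x $ e k))"
    proof
      fix p assume "p \<in> P"
      then obtain f where "has_coordinates p f" "\<And>i. rational_function \<beta> (f i)"
        using P(2) unfolding description_complexity_def by blast
      then show "\<exists>v :: nat \<Rightarrow> real poly. (\<forall>k\<le>?d. degree (v k) \<le> ?d * \<beta>) \<and>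
       (\<forall>t\<ge>0. \<forall>x. p t = Some x \<longrightarrow> poly (v 0) t \<noteq> 0 \<and> (\<forall>k\<in>{1..?d}. dehom v t k = x $ e k))"
        using e by (intro exists_homogeneous_coordinates) (auto simp: bij_betw_def)
    qed
    from bchoice[OF this] obtain V where V: "\<forall>p\<in>P. (\<forall>k\<le>?d. degree (V p k) \<le> ?d * \<beta>) \<and>
       (\<forall>t\<ge>0. \<forall>x. p t = Some x \<longrightarrow> poly (V p 0) t \<noteq> 0 \<and> (\<forall>k\<in>{1..?d}. dehom (V p) t k = x $ e k))" ..
    from spec[OF D, of \<beta>] obtain \<alpha> :: real where \<alpha>: "0 < \<alpha>" and nets: "\<forall>r (P :: 'd moving_point set) V. 2 \<le> r \<longrightarrow>
       finite P \<longrightarrow> P \<noteq> {} \<longrightarrow> (\<forall>p\<in>P. \<forall>k\<le>?d. degree (V p k) \<le> ?d * \<beta>) \<longrightarrow>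
       (\<exists>N. finite N \<and> card N \<le> K \<beta> * ?b r \<and>
          (\<forall>w\<in>N. \<forall>k\<le>?d. degree (w k) \<le> D \<beta>) \<and> flat_net V P r ?d \<alpha> N)"
      by (elim exE conjE) (rule that)
    have "\<exists>N. finite N \<and> card N \<le> K \<beta> * ?b r \<and>
          (\<forall>w\<in>N. \<forall>k\<le>?d. degree (w k) \<le> D \<beta>) \<and> flat_net V P r ?d \<alpha> N"
      by (rule nets[rule_format, OF r2 P(1) P2]) (use V in blast)
    then obtain N where N: "finite N" "card N \<le> K \<beta> * ?b r"
      "\<forall>w\<in>N. \<forall>k\<le>?d. degree (w k) \<le> D \<beta>" "flat_net V P r ?d \<alpha> N"
      by (elim exE conjE) (rule that)
    let ?idx = "inv_into {1..?d} e"
    let ?N = "moving_point_of ?idx ` {w \<in> N. w 0 \<noteq> 0}"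
    have "kinetic_weak_net r P ?N"
      by (rule kinetic_weak_net_of_flat_net[OF P(1) _ \<alpha> e _ N(4)]) (use r V in auto)
    moreover have "description_complexity (D \<beta>) ?N"
    proof (rule description_complexity_moving_point_of)
      fix i
      have "i \<in> e ` {1..?d}" using e by (simp add: bij_betw_def)
      then have "?idx i \<in> {1..?d}" by (rule inv_into_into)
      then show "?idx i \<le> ?d" by simp
    qed (use N(3) in auto)
    moreover have "card ?N \<le> c r \<beta>"
    proof -
      have "card ?N \<le> card {w \<in> N. w 0 \<noteq> 0}" using N(1) by (intro card_image_le) simp
      also have "\<dots> \<le> card N" using N(1) by (intro card_mono) auto
      finally show ?thesis using N(2) unfolding c_def by linarith
    qed
    moreover have "finite ?N" using N(1) by simp
    ultimately show ?thesis by (intro exI[of _ ?N] conjI)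
  qed
  have "real (c r \<beta>) \<le> K \<beta> * ?b r" if "2 \<le> r" for r \<beta>
  proof -
    have "0 < K \<beta>" using spec[OF D, of \<beta>] by (elim exE conjE)
    then have "0 \<le> K \<beta> * ?b r" using that by simp
    then show ?thesis by (simp add: c_def)
  qed
  then have "\<forall>\<beta>\<ge>1. \<exists>K :: real. \<forall>r\<ge>2. real (c r \<beta>) \<le> K * ?b r" by blast
  moreover have "\<forall>r \<beta>. r \<ge> 1 \<and> \<beta> \<ge> 1 \<longrightarrow> (\<forall>P :: 'd moving_point set.
       finite P \<and> description_complexity \<beta> P \<and> general_position P \<longrightarrow>
         (\<exists>N. kinetic_weak_net r P N \<and> finite N \<and> card N \<le> c r \<beta> \<and> description_complexity (D \<beta>) N))"
    using exN by blast
  ultimately show ?thesis by (intro exI[of _ c] exI[of _ D] conjI)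
qed

end
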